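(* Let $\boldsymbol h=(h_1,\ldots,h_n)$ be a homogeneous self-vanishing system in $K[x_1,\ldots,x_n]$. Then $$\operatorname{rank}\left(\frac{\partial h_i}{\partial x_j}\right)=\operatorname{tr.deg}_K K(h_1,\ldots,h_n)=\operatorname{Krull\,dim} K[h_1,\ldots,h_n]\le n-1,$$ and if moreover $n\ge 3$, then $$\operatorname{rank}\left(\frac{\partial h_i}{\partial x_j}\right)=\operatorname{tr.deg}_K K(h_1,\ldots,h_n)=\operatorname{Krull\,dim} K[h_1,\ldots,h_n]\le n-2.$$ Here the rank is that of the $n\times n$ Jacobian matrix over $K(x_1,\ldots,x_n)$.
   Context: $K$ is an algebraically closed field of characteristic zero. A homogeneous self-vanishing system is a vector $\boldsymbol h=(h_1,\ldots,h_n)$ of homogeneous polynomials $h_i\in K[x_1,\ldots,x_n]$ of the same degree such that $\sum_{k=1}^n h_k\frac{\partial h_j}{\partial x_k}=0$ for all $j=1,\ldots,n$. $K[h_1,\ldots,h_n]$ and $K(h_1,\ldots,h_n)$ denote the $K$-subalgebra of $K[x_1,\ldots,x_n]$ and the subfield of $K(x_1,\ldots,x_n)$ generated by the $h_i$. *)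

theory Defs
  imports
    "HOL-Analysis.Cartesian_Space"
    "HOL-Library.Poly_Mapping"
    "HOL-Library.Extended_Nat"
    "HOL-Computational_Algebra.Normalized_Fraction"
    "HOL-Algebra.Generated_Fields"
    "HOL-Algebra.Ideal"
    "HOL-Algebra.Algebraic_Closure_Type"
begin

text \<open>
  The polynomial ring $K[x_1,\ldots,x_n]$. The variables are indexed by a finite type with $n$
  elements; a linear order on this type is needed only for the library's proof that the ring
  is an integral domain, and plays no role otherwise.
\<close>

type_synonym ('n, 'a) mpoly = "('n \<Rightarrow>\<^sub>0 nat) \<Rightarrow>\<^sub>0 'a"

definition mconst :: "'a::zero \<Rightarrow> ('n, 'a) mpoly" where
  "mconst c = Poly_Mapping.single 0 c"

definition homogeneous :: "nat \<Rightarrow> ('n::finite, 'a::zero) mpoly \<Rightarrow> bool" where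
  "homogeneous d p \<longleftrightarrow> (\<forall>m\<in>Poly_Mapping.keys p. (\<Sum>i\<in>UNIV. Poly_Mapping.lookup m i) = d)"

text \<open>
  Subtraction of exponents is truncated, but this only affects monomials not containing $x_i$,
  and those get coefficient $0$.
\<close>

definition partial_deriv :: "'n \<Rightarrow> ('n, 'a::comm_semiring_1) mpoly \<Rightarrow> ('n, 'a) mpoly" where
  "partial_deriv i p =
     (\<Sum>m\<in>Poly_Mapping.keys p.
        Poly_Mapping.single (m - Poly_Mapping.single i 1)
          (of_nat (Poly_Mapping.lookup m i) * Poly_Mapping.lookup p m))"

text \<open>The zero polynomial counts as homogeneous of every degree.\<close>

definition homogeneous_self_vanishing :: "(('n::finite, 'a::comm_ring_1) mpoly, 'n) vec \<Rightarrow> bool" where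
  "homogeneous_self_vanishing h \<longleftrightarrow>
     (\<exists>d. \<forall>i. homogeneous d (h $ i)) \<and>
     (\<forall>j. (\<Sum>k\<in>UNIV. h $ k * partial_deriv k (h $ j)) = 0)"

definition jacobian ::
  "(('n::{finite,linorder}, 'a::idom) mpoly, 'n) vec \<Rightarrow> ((('n, 'a) mpoly fract, 'n) vec, 'n) vec" where
  "jacobian h = (\<chi> i j. to_fract (partial_deriv j (h $ i)))"

definition gen_subalgebra :: "(('n::{finite,linorder}, 'a::idom) mpoly, 'n) vec \<Rightarrow> ('n, 'a) mpoly set" where
  "gen_subalgebra h = generate_ring ring_of_type_algebra (range mconst \<union> range (($) h))"

definition const_field :: "('n::{finite,linorder}, 'a::field) mpoly fract set" where
  "const_field = range (\<lambda>c. to_fract (mconst c))"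

definition gen_subfield ::
  "(('n::{finite,linorder}, 'a::field) mpoly, 'n) vec \<Rightarrow> ('n, 'a) mpoly fract set" where
  "gen_subfield h =
     generate_field ring_of_type_algebra (const_field \<union> range (\<lambda>i. to_fract (h $ i)))"

text \<open>
  Polynomials over a field whose variables are (formal copies of) the field elements
  themselves; evaluation replaces every variable by the element naming it.
\<close>

definition eval_self :: "('l::field, 'l) mpoly \<Rightarrow> 'l" where
  "eval_self p =
     (\<Sum>m\<in>Poly_Mapping.keys p.
        Poly_Mapping.lookup p m * (\<Prod>s\<in>Poly_Mapping.keys m. s ^ Poly_Mapping.lookup m s))"

text \<open>
  The set \<open>S\<close> is algebraically independent over the subfield \<open>F\<close>: no nonzero polynomial with
  coefficients in \<open>F\<close> and variables in \<open>S\<close> vanishes.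
\<close>

definition alg_independent :: "'l::field set \<Rightarrow> 'l set \<Rightarrow> bool" where
  "alg_independent F S \<longleftrightarrow>
     (\<forall>p :: ('l, 'l) mpoly.
        Poly_Mapping.range p \<subseteq> F \<and> (\<forall>m\<in>Poly_Mapping.keys p. Poly_Mapping.keys m \<subseteq> S) \<and>
        eval_self p = 0 \<longrightarrow> p = 0)"

text \<open>
  The transcendence degree of \<open>E\<close> over \<open>F\<close>, for subfields \<open>F \<subseteq> E\<close> of an ambient field, as the
  largest cardinality of an algebraically independent subset; infinite cardinals are all
  identified with \<open>\<infinity>\<close>.
\<close>

definition tr_deg :: "'l::field set \<Rightarrow> 'l set \<Rightarrow> enat" where
  "tr_deg F E = Sup {enat (card S) |S. finite S \<and> S \<subseteq> E \<and> alg_independent F S}"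

text \<open>
  The supremum of the lengths \<open>k\<close> of chains $P_0 \subset \cdots \subset P_k$ of prime ideals.
  For the zero ring this gives \<open>0\<close>.
\<close>

definition krull_dim :: "('r, 's) ring_scheme \<Rightarrow> enat" where
  "krull_dim R =
     Sup {enat k |k. \<exists>P. (\<forall>i\<le>k. primeideal (P i) R) \<and> (\<forall>i<k. P i \<subset> P (Suc i))}"

end

theory Submission
  imports Defs "HOL-Analysis.Determinants"
begin

text \<open>
  Rank and transcendence degree agree by the Jacobian criterion, and Krull dimension lies between
  them: a strict chain of primes yields algebraically independent elements (one from each
  step), while restricting \<open>h\<close> to a flag of affine subspaces through a point at which \<open>rank J\<close> rows
  of the Jacobian matrix are independent yields a chain of primes of length \<open>rank J\<close>.

  Since \<open>J h = 0\<close>, the rank is at most \<open>n - 1\<close>. For the sharper bound, the derivation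
  \<open>D = \<Sum>k. h\<^sub>k \<partial>\<^sub>k\<close> is locally nilpotent with flow \<open>x + t h(x)\<close>, so \<open>h(x + t h(x)) = h(x)\<close> and
  hence \<open>h(h(x)) = 0\<close> by homogeneity. If the rank were \<open>n - 1\<close>, the image of \<open>h\<close> would be a
  hypersurface \<open>F = 0\<close>, so \<open>F\<close> would divide every \<open>h\<^sub>i\<close>. The kernel of \<open>D\<close> is closed under taking factors,
  so \<open>h / F\<close> is again self-vanishing, of smaller degree, and its rank is not smaller unless
  \<open>h\<close> has rank at most one; descent on the degree finishes the proof.
\<close>

section \<open>Evaluation homomorphisms and derivations\<close>

text \<open>That \<open>F\<close> divides every component rests on irreducible polynomials being
  prime, which is proved by adjoining the variables one at a time. \<open>F\<close> is a relation of
  least degree; if it failed to divide some \<open>h $ i\<close>, eliminating from the two the one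
  variable that every nonzero relation must contain would leave a nonzero relation between n - 1
  independent components. Counting is the other input: m rational functions in t < m variables are
  dependent, because their power products outnumber the monomials available after clearing
  denominators. This bounds independent sets in the Jacobian criterion and supplies the relations
  that make the chain of primes strict. The descent keeps the rank by Euler's identity: if h = F g
  with g homogeneous of positive degree, the Jacobian matrix of h factors through that of g. If g is
  constant, the rank may drop from 1 to 0; this is harmless exactly when 1 \<le> n - 2, and here n
  \<ge> 3 enters.\<close>

definition pvar :: "'i \<Rightarrow> ('i, 'a::zero_neq_one) mpoly" where
  "pvar i = Poly_Mapping.single (Poly_Mapping.single i 1) 1"

definition monomial_value :: "('i \<Rightarrow> 'b::comm_monoid_mult) \<Rightarrow> ('i \<Rightarrow>\<^sub>0 nat) \<Rightarrow> 'b" where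
  "monomial_value v m = (\<Prod>i\<in>Poly_Mapping.keys m. v i ^ Poly_Mapping.lookup m i)"

text \<open>The coefficient map is a parameter because the targets vary: the scalars themselves,
  polynomial rings, univariate polynomials over these, and the fraction field. Every substitution
  below is an instance.\<close>

definition ev :: "('a::zero \<Rightarrow> 'b::comm_semiring_1) \<Rightarrow> ('i \<Rightarrow> 'b) \<Rightarrow> ('i, 'a) mpoly \<Rightarrow> 'b" where
  "ev c v p = (\<Sum>m\<in>Poly_Mapping.keys p. c (Poly_Mapping.lookup p m) * monomial_value v m)"

text \<open>The subring K[S] is a predicate rather than a type, so that inductions can adjoin or
  remove single variables.\<close>

definition vars_in :: "'i set \<Rightarrow> ('i, 'a::zero) mpoly \<Rightarrow> bool" where
  "vars_in S p \<longleftrightarrow> (\<forall>m\<in>Poly_Mapping.keys p. Poly_Mapping.keys m \<subseteq> S)"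

lemma monomial_value_superset:
  assumes "finite A" "Poly_Mapping.keys m \<subseteq> A"
  shows "monomial_value v m = (\<Prod>i\<in>A. v i ^ Poly_Mapping.lookup m i)"
  unfolding monomial_value_def
  using assms by (intro prod.mono_neutral_left) (auto simp: in_keys_iff)

lemma monomial_value_0 [simp]: "monomial_value v 0 = 1"
  by (simp add: monomial_value_def)

lemma monomial_value_single [simp]: "monomial_value v (Poly_Mapping.single i k) = v i ^ k"
  by (simp add: monomial_value_def)

lemma monomial_value_add: "monomial_value v (a + b) = monomial_value v a * monomial_value v b"
proof -
  define A where "A = Poly_Mapping.keys a \<union> Poly_Mapping.keys b"
  have A: "finite A" "Poly_Mapping.keys a \<subseteq> A" "Poly_Mapping.keys b \<subseteq> A"
    "Poly_Mapping.keys (a + b) \<subseteq> A"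
    using keys_add[of a b] by (auto simp: A_def)
  show ?thesis
    using A by (simp add: monomial_value_superset[of A] lookup_add power_add prod.distrib)
qed

lemma vars_in_mono: "vars_in S p \<Longrightarrow> S \<subseteq> T \<Longrightarrow> vars_in T p"
  by (auto simp: vars_in_def)

lemma vars_in_UNIV [simp]: "vars_in UNIV p"
  by (simp add: vars_in_def)

lemma vars_in_Int: "vars_in S p \<Longrightarrow> vars_in T p \<Longrightarrow> vars_in (S \<inter> T) p"
  by (auto simp: vars_in_def)

lemma vars_in_0 [simp]: "vars_in S 0"
  by (simp add: vars_in_def)

lemma vars_in_1 [simp]: "vars_in S 1"
  by (simp add: vars_in_def)

lemma vars_in_mconst [simp]: "vars_in S (mconst c)"
  by (simp add: vars_in_def mconst_def)

lemma vars_in_pvar [simp]: "vars_in S (pvar i) \<longleftrightarrow> i \<in> S"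
  by (simp add: vars_in_def pvar_def)

lemma vars_in_add [simp]: "vars_in S p \<Longrightarrow> vars_in S q \<Longrightarrow> vars_in S (p + q)"
  using keys_add[of p q] unfolding vars_in_def by blast

lemma vars_in_uminus [simp]: "vars_in S (- p) \<longleftrightarrow> vars_in S (p :: ('i, 'a::ab_group_add) mpoly)"
  by (simp add: vars_in_def in_keys_iff)

lemma vars_in_diff [simp]:
  "vars_in S p \<Longrightarrow> vars_in S q \<Longrightarrow> vars_in S (p - q :: ('i, 'a::ab_group_add) mpoly)"
  using vars_in_add[of S p "- q"] by simp

lemma vars_in_mult [simp]:
  assumes "vars_in S p" "vars_in S q"
  shows "vars_in S (p * q :: ('i, 'a::comm_semiring_1) mpoly)"
  unfolding vars_in_def
proof
  fix m assume "m \<in> Poly_Mapping.keys (p * q)"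
  then obtain a b where "m = a + b" "a \<in> Poly_Mapping.keys p" "b \<in> Poly_Mapping.keys q"
    using keys_mult[of p q] by blast
  then show "Poly_Mapping.keys m \<subseteq> S"
    using assms keys_add[of a b] unfolding vars_in_def by blast
qed

lemma vars_in_power [simp]: "vars_in S p \<Longrightarrow> vars_in S (p ^ k :: ('i, 'a::comm_semiring_1) mpoly)"
  by (induction k) auto

lemma vars_in_sum [simp]: "(\<And>a. a \<in> A \<Longrightarrow> vars_in S (f a)) \<Longrightarrow> vars_in S (sum f A)"
  by (induction A rule: infinite_finite_induct) auto

lemma mconst_0 [simp]: "mconst 0 = 0"
  by (simp add: mconst_def)

lemma mconst_1 [simp]: "mconst 1 = 1"
  by (simp add: mconst_def)

lemma mconst_add: "mconst (a + b) = mconst a + mconst b"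
  by (simp add: mconst_def single_add)

lemma mconst_mult: "mconst (a * b) = mconst a * (mconst b :: ('i, 'a::comm_semiring_1) mpoly)"
  by (simp add: mconst_def mult_single)

lemma mconst_eq_0_iff [simp]: "mconst a = 0 \<longleftrightarrow> a = 0"
  by (metis mconst_def lookup_single_eq lookup_zero mconst_0)

lemma mconst_of_nat: "mconst (of_nat n) = (of_nat n :: ('i, 'a::comm_semiring_1) mpoly)"
  by (induction n) (auto simp: mconst_add)

lemma mpoly_sum_single: "p = (\<Sum>m\<in>Poly_Mapping.keys p. Poly_Mapping.single m (Poly_Mapping.lookup p m))"
proof (rule poly_mapping_eqI)
  fix k
  show "Poly_Mapping.lookup p k = Poly_Mapping.lookup
      (\<Sum>m\<in>Poly_Mapping.keys p. Poly_Mapping.single m (Poly_Mapping.lookup p m)) k"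
    by (simp add: lookup_sum lookup_single when_def in_keys_iff)
qed

lemma single_eq_monomial_value:
  "Poly_Mapping.single m a = mconst a * monomial_value pvar (m :: 'i \<Rightarrow>\<^sub>0 nat)"
  for a :: "'a::comm_semiring_1"
proof -
  have pow: "pvar i ^ k = Poly_Mapping.single (Poly_Mapping.single i k) (1::'a)" for i :: 'i and k
    by (induction k) (auto simp: pvar_def mult_single single_add[symmetric])
  have "(\<Prod>i\<in>A. pvar i ^ f i) = Poly_Mapping.single (\<Sum>i\<in>A. Poly_Mapping.single i (f i)) (1::'a)"
    if "finite A" for A :: "'i set" and f
    using that by (induction A) (auto simp: pow mult_single)
  then show ?thesis
    using mpoly_sum_single[of m] by (simp add: monomial_value_def mconst_def mult_single)
qed

lemma mpoly_induct [case_names single add]: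
  fixes p :: "('i, 'a::comm_monoid_add) mpoly"
  assumes "\<And>m a. P (Poly_Mapping.single m a)" "\<And>p q. P p \<Longrightarrow> P q \<Longrightarrow> P (p + q)"
  shows "P p"
proof -
  have "P (\<Sum>m\<in>A. Poly_Mapping.single m (Poly_Mapping.lookup p m))" if "finite A" for A
    using that
  proof induction
    case empty
    then show ?case using assms(1)[of 0 0] by simp
  qed (auto intro: assms)
  then show ?thesis
    using mpoly_sum_single[of p] by (metis finite_keys)
qed

text \<open>Reduces a claim about K[S] to ring generators while keeping track of the variables that
  occur.\<close>

lemma vars_in_induct [consumes 1, case_names const var add mult]:
  fixes p :: "('i, 'a::comm_semiring_1) mpoly"
  assumes p: "vars_in S p"
    and const: "\<And>c. P (mconst c)" and var: "\<And>i. i \<in> S \<Longrightarrow> P (pvar i)"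
    and add: "\<And>p q. vars_in S p \<Longrightarrow> vars_in S q \<Longrightarrow> P p \<Longrightarrow> P q \<Longrightarrow> P (p + q)"
    and mult: "\<And>p q. vars_in S p \<Longrightarrow> vars_in S q \<Longrightarrow> P p \<Longrightarrow> P q \<Longrightarrow> P (p * q)"
  shows "P p"
proof -
  have 1: "vars_in S (1 :: ('i, 'a) mpoly) \<and> P 1" using const[of 1] by simp
  have pow: "vars_in S (pvar i ^ k :: ('i, 'a) mpoly) \<and> P (pvar i ^ k)" if "i \<in> S" for i k
    using that by (induction k) (auto intro: mult var simp: 1)
  have mon: "vars_in S (\<Prod>i\<in>A. pvar i ^ f i :: ('i, 'a) mpoly) \<and> P (\<Prod>i\<in>A. pvar i ^ f i)"
    if "finite A" "A \<subseteq> S" for A f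
    using that by (induction A) (auto intro: mult simp: 1 pow)
  have single: "vars_in S (Poly_Mapping.single m a) \<and> P (Poly_Mapping.single m a)"
    if "Poly_Mapping.keys m \<subseteq> S" for m a
    unfolding single_eq_monomial_value monomial_value_def
    using mon[of "Poly_Mapping.keys m"] that by (auto intro: mult const)
  have "vars_in S (\<Sum>m\<in>A. Poly_Mapping.single m (Poly_Mapping.lookup p m)) \<and>
      P (\<Sum>m\<in>A. Poly_Mapping.single m (Poly_Mapping.lookup p m))"
    if "finite A" "A \<subseteq> Poly_Mapping.keys p" for A
    using that
  proof induction
    case empty
    then show ?case using const[of 0] by simp
  next
    case (insert x F)
    then show ?case using p single by (auto intro!: add simp: vars_in_def[of S p])
  qed
  then show ?thesis
    using mpoly_sum_single[of p] by (metis finite_keys subset_refl)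
qed

section \<open>Substitution homomorphisms and their universal property\<close>

locale coeff_hom =
  fixes c :: "'a::comm_ring_1 \<Rightarrow> 'b::comm_ring_1"
  assumes hom_add: "c (x + y) = c x + c y" and hom_mult: "c (x * y) = c x * c y"
    and hom_1 [simp]: "c 1 = 1"
begin

lemma hom_0 [simp]: "c 0 = 0"
  using hom_add[of 0 0] by simp

lemma hom_sum: "c (sum f A) = (\<Sum>a\<in>A. c (f a))"
  by (induction A rule: infinite_finite_induct) (auto simp: hom_add)

lemma hom_prod: "c (prod f A) = (\<Prod>a\<in>A. c (f a))"
  by (induction A rule: infinite_finite_induct) (auto simp: hom_mult)

lemma hom_uminus: "c (- x) = - c x"
  using hom_add[of x "-x"] by (simp add: eq_neg_iff_add_eq_0 add.commute)

lemma hom_diff: "c (x - y) = c x - c y"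
  using hom_add[of x "-y"] by (simp add: hom_uminus)

lemma hom_power: "c (x ^ k) = c x ^ k"
  by (induction k) (auto simp: hom_mult)

lemma hom_of_nat: "c (of_nat k) = of_nat k"
  by (induction k) (auto simp: hom_add)

lemma ev_single: "ev c v (Poly_Mapping.single m a) = c a * monomial_value v m"
  by (simp add: ev_def)

lemma ev_mconst [simp]: "ev c v (mconst a) = c a"
  by (simp add: mconst_def ev_single)

lemma ev_pvar [simp]: "ev c v (pvar i) = v i"
  by (simp add: pvar_def ev_single)

lemma ev_0 [simp]: "ev c v 0 = 0"
  by (simp add: ev_def)

lemma ev_1 [simp]: "ev c v 1 = 1"
  using ev_mconst[of v 1] by simp

lemma ev_add: "ev c v (p + q) = ev c v p + ev c v q"
  unfolding ev_def
  by (rule setsum_keys_plus_distrib) (auto simp: hom_add algebra_simps)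

lemma ev_mult: "ev c v (p * q) = ev c v p * ev c v q"
proof (induction p rule: mpoly_induct)
  case (single m a)
  show ?case
  proof (induction q rule: mpoly_induct)
    case (single m' a')
    then show ?case
      by (simp add: mult_single ev_single hom_mult monomial_value_add mult_ac)
  qed (simp add: distrib_left ev_add)
qed (simp add: distrib_right ev_add)

lemma coeff_hom_ev: "coeff_hom (ev c v)"
  by standard (auto simp: ev_add ev_mult)

end

lemma coeff_hom_id: "coeff_hom (\<lambda>x. x)"
  by standard auto

lemma coeff_hom_mconst: "coeff_hom (mconst :: _ \<Rightarrow> ('i, 'a::comm_ring_1) mpoly)"
  by standard (auto simp: mconst_add mconst_mult)

lemma coeff_hom_comp: "coeff_hom f \<Longrightarrow> coeff_hom g \<Longrightarrow> coeff_hom (\<lambda>x. f (g x))"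
  by (simp add: coeff_hom_def)

lemma coeff_hom_to_fract: "coeff_hom to_fract"
  by standard auto

lemma coeff_hom_const_poly: "coeff_hom (\<lambda>x. [:x:])"
  by standard (auto simp: one_pCons)

lemma coeff_hom_poly: "coeff_hom (\<lambda>p. poly p x)"
  by standard auto

lemma hom_eqI:
  fixes p :: "('i, 'a::comm_ring_1) mpoly"
  assumes "coeff_hom f" "coeff_hom g" "vars_in S p"
    and "\<And>a. f (mconst a) = g (mconst a)" "\<And>i. i \<in> S \<Longrightarrow> f (pvar i) = g (pvar i)"
  shows "f p = g p"
  using assms(3)
proof (induction p rule: vars_in_induct)
qed (use assms in \<open>auto simp: coeff_hom.hom_add coeff_hom.hom_mult\<close>)

lemma ev_cong:
  assumes "coeff_hom c" "vars_in S p" "\<And>i. i \<in> S \<Longrightarrow> v i = w i"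
  shows "ev c v p = ev c w p"
  by (rule hom_eqI[where S = S]) (use assms in \<open>auto intro: coeff_hom.coeff_hom_ev simp: coeff_hom.ev_mconst coeff_hom.ev_pvar\<close>)

lemma hom_ev:
  assumes "coeff_hom c" "coeff_hom f"
  shows "f (ev c v p) = ev (\<lambda>a. f (c a)) (\<lambda>i. f (v i)) p"
proof -
  have h: "coeff_hom (\<lambda>a. f (c a))" using assms coeff_hom_comp by blast
  show ?thesis
    by (rule hom_eqI[where S = UNIV])
      (use assms h in \<open>auto intro: coeff_hom_comp coeff_hom.coeff_hom_ev
        simp: coeff_hom.ev_mconst coeff_hom.ev_pvar\<close>)
qed

lemma ev_mconst_pvar [simp]: "ev mconst pvar p = (p :: ('i, 'a::comm_ring_1) mpoly)"
  by (rule hom_eqI[where S = UNIV and g = "\<lambda>x. x"])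
    (auto intro: coeff_hom.coeff_hom_ev coeff_hom_mconst coeff_hom_id
      simp: coeff_hom.ev_mconst[OF coeff_hom_mconst] coeff_hom.ev_pvar[OF coeff_hom_mconst])

lemma ev_closed:
  fixes c :: "'a::comm_ring_1 \<Rightarrow> 'b::comm_ring_1"
  assumes "coeff_hom c" "vars_in S p" "\<And>a. c a \<in> R" "\<And>i. i \<in> S \<Longrightarrow> v i \<in> R"
    "\<And>x y. x \<in> R \<Longrightarrow> y \<in> R \<Longrightarrow> x + y \<in> R" "\<And>x y. x \<in> R \<Longrightarrow> y \<in> R \<Longrightarrow> x * y \<in> R"
  shows "ev c v p \<in> R"
  using assms(2)
  by (induction p rule: vars_in_induct)
    (use assms in \<open>auto simp: coeff_hom.ev_mconst coeff_hom.ev_pvar coeff_hom.ev_add coeff_hom.ev_mult\<close>)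

lemma vars_in_ev:
  assumes "coeff_hom c" "vars_in S p" "\<And>a. vars_in T (c a)" "\<And>i. i \<in> S \<Longrightarrow> vars_in T (v i)"
  shows "vars_in T (ev c v p :: ('j, 'a::comm_ring_1) mpoly)"
  using ev_closed[of c S p "Collect (vars_in T)" v] assms by simp

section \<open>Partial derivatives and the chain rule\<close>

lemma partial_deriv_single:
  "partial_deriv i (Poly_Mapping.single m a) =
    Poly_Mapping.single (m - Poly_Mapping.single i 1) (of_nat (Poly_Mapping.lookup m i) * a)"
  by (cases "a = 0") (auto simp: partial_deriv_def)

lemma partial_deriv_0 [simp]: "partial_deriv i 0 = 0"
  by (simp add: partial_deriv_def)

lemma partial_deriv_mconst [simp]: "partial_deriv i (mconst a) = 0"
  by (simp add: mconst_def partial_deriv_single)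

lemma partial_deriv_pvar: "partial_deriv i (pvar j) = (if i = j then 1 else 0)"
  by (simp add: pvar_def partial_deriv_single lookup_single when_def single_one)

lemma partial_deriv_add: "partial_deriv i (p + q) = partial_deriv i p + partial_deriv i q"
  unfolding partial_deriv_def
  by (rule setsum_keys_plus_distrib) (auto simp: algebra_simps single_add)

lemma partial_deriv_sum: "partial_deriv i (sum f A) = (\<Sum>a\<in>A. partial_deriv i (f a))"
  by (induction A rule: infinite_finite_induct) (auto simp: partial_deriv_add)

lemma partial_deriv_mult: "partial_deriv i (p * q) = p * partial_deriv i q + q * partial_deriv i p"
proof (induction p rule: mpoly_induct)
  case (single m a)
  show ?case
  proof (induction q rule: mpoly_induct)
    case (single m' a')
    have eq: "x + (y - Poly_Mapping.single i 1) = x + y - Poly_Mapping.single i 1"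
      if "Poly_Mapping.lookup y i \<noteq> 0" for x y :: "'a \<Rightarrow>\<^sub>0 nat"
      by (rule poly_mapping_eqI) (use that in \<open>auto simp: lookup_add lookup_minus lookup_single when_def\<close>)
    show ?case
      using eq[of m m'] eq[of m' m]
      by (cases "Poly_Mapping.lookup m i = 0"; cases "Poly_Mapping.lookup m' i = 0")
        (auto simp: partial_deriv_single mult_single lookup_add single_add[symmetric] algebra_simps)
  qed (simp add: distrib_left distrib_right partial_deriv_add algebra_simps)
qed (simp add: distrib_left distrib_right partial_deriv_add algebra_simps)

text \<open>A derivation along \<open>f\<close> that kills constants is determined by its values on
  the variables. The instances are chain rules: for \<open>pderiv\<close> after a substitution, for
  partial derivatives of a restriction, and for the fraction field.\<close>

lemma derivation_eq:
  fixes p :: "('i, 'a::comm_ring_1) mpoly"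
  assumes S: "finite S" "vars_in S p" and f: "coeff_hom f"
    and add: "\<And>p q. d (p + q) = d p + d q" and mult: "\<And>p q. d (p * q) = f p * d q + f q * d p"
    and const: "\<And>a. d (mconst a) = 0"
  shows "d p = (\<Sum>i\<in>S. f (partial_deriv i p) * d (pvar i))"
  using S(2)
proof (induction p rule: vars_in_induct)
  case (const c)
  then show ?case using f by (simp add: assms coeff_hom.hom_0)
next
  case (var i)
  then show ?case using S(1) f
    by (simp add: partial_deriv_pvar if_distrib[of f] if_distrib[of "\<lambda>x. x * _"] coeff_hom.hom_0 coeff_hom.hom_1 cong: if_cong)
next
  case (add p q)
  then show ?case using f
    by (simp add: assms(4) partial_deriv_add coeff_hom.hom_add distrib_right sum.distrib)
next
  case (mult p q)
  then show ?case using f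
    by (simp add: assms(5) partial_deriv_mult coeff_hom.hom_add coeff_hom.hom_mult distrib_right
        distrib_left sum.distrib sum_distrib_left mult_ac)
qed

section \<open>Gauss's lemma for polynomials in finitely many variables\<close>

text \<open>Regards p as a polynomial in x_k. The coefficients keep the full polynomial type; that
  they are free of x_k is recorded by \<open>vars_in_coeff_poly_in_var\<close>.\<close>

definition poly_in_var :: "'i \<Rightarrow> ('i, 'a::comm_ring_1) mpoly \<Rightarrow> ('i, 'a) mpoly poly" where
  "poly_in_var k = ev (\<lambda>a. [:mconst a:]) (\<lambda>i. if i = k then [:0, 1:] else [:pvar i:])"

text \<open>The polynomial \<open>p(t x)\<close> in \<open>t\<close>; its degree is the total degree of \<open>p\<close>.\<close>

definition scaling_poly :: "('i, 'a::comm_ring_1) mpoly \<Rightarrow> ('i, 'a) mpoly poly" where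
  "scaling_poly = ev (\<lambda>a. [:mconst a:]) (\<lambda>i. [:0, pvar i:])"

abbreviation tdeg :: "('i, 'a::comm_ring_1) mpoly \<Rightarrow> nat" where
  "tdeg p \<equiv> degree (scaling_poly p)"

lemma coeff_hom_const_poly_mconst: "coeff_hom (\<lambda>a. [:mconst a:])"
  using coeff_hom_comp[OF coeff_hom_const_poly coeff_hom_mconst] by simp

lemma coeff_hom_poly_in_var: "coeff_hom (poly_in_var k)"
  unfolding poly_in_var_def by (rule coeff_hom.coeff_hom_ev[OF coeff_hom_const_poly_mconst])

lemma coeff_hom_scaling_poly: "coeff_hom scaling_poly"
  unfolding scaling_poly_def by (rule coeff_hom.coeff_hom_ev[OF coeff_hom_const_poly_mconst])

lemmas poly_in_var_hom = coeff_hom.hom_add[OF coeff_hom_poly_in_var] coeff_hom.hom_mult[OF coeff_hom_poly_in_var]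
  coeff_hom.hom_diff[OF coeff_hom_poly_in_var] coeff_hom.hom_power[OF coeff_hom_poly_in_var]

lemmas scaling_poly_hom = coeff_hom.hom_add[OF coeff_hom_scaling_poly] coeff_hom.hom_mult[OF coeff_hom_scaling_poly]

lemma poly_in_var_0 [simp]: "poly_in_var k 0 = 0"
  by (rule coeff_hom.hom_0[OF coeff_hom_poly_in_var])

lemma scaling_poly_0 [simp]: "scaling_poly 0 = 0"
  by (rule coeff_hom.hom_0[OF coeff_hom_scaling_poly])

lemma scaling_poly_1 [simp]: "scaling_poly 1 = 1"
  by (rule coeff_hom.hom_1[OF coeff_hom_scaling_poly])

lemma poly_in_var_mconst [simp]: "poly_in_var k (mconst a) = [:mconst a:]"
  by (simp add: poly_in_var_def coeff_hom.ev_mconst[OF coeff_hom_const_poly_mconst])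

lemma scaling_poly_mconst [simp]: "scaling_poly (mconst a) = [:mconst a:]"
  by (simp add: scaling_poly_def coeff_hom.ev_mconst[OF coeff_hom_const_poly_mconst])

lemma poly_in_var_pvar: "poly_in_var k (pvar i) = (if i = k then [:0, 1:] else [:pvar i:])"
  by (simp add: poly_in_var_def coeff_hom.ev_pvar[OF coeff_hom_const_poly_mconst])

lemma scaling_poly_pvar [simp]: "scaling_poly (pvar i) = [:0, pvar i:]"
  by (simp add: scaling_poly_def coeff_hom.ev_pvar[OF coeff_hom_const_poly_mconst])

lemma poly_poly_in_var: "poly (poly_in_var k p) (pvar k) = p"
  by (rule hom_eqI[where S = UNIV and g = "\<lambda>x. x" and f = "\<lambda>p. poly (poly_in_var k p) (pvar k)"])
    (auto intro: coeff_hom_comp coeff_hom_poly coeff_hom_poly_in_var coeff_hom_id simp: poly_in_var_pvar)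

lemma poly_scaling_poly_1: "poly (scaling_poly p) 1 = p"
  by (rule hom_eqI[where S = UNIV and g = "\<lambda>x. x" and f = "\<lambda>p. poly (scaling_poly p) 1"])
    (auto intro: coeff_hom_comp coeff_hom_poly coeff_hom_scaling_poly coeff_hom_id)

lemma poly_in_var_eq_0_iff [simp]: "poly_in_var k p = 0 \<longleftrightarrow> p = 0"
  using poly_poly_in_var[of k p] by auto

lemma scaling_poly_eq_0_iff [simp]: "scaling_poly p = 0 \<longleftrightarrow> p = 0"
  using poly_scaling_poly_1[of p] by auto

lemma poly_in_var_const: "k \<notin> S \<Longrightarrow> vars_in S p \<Longrightarrow> poly_in_var k p = [:p:]"
  by (rule hom_eqI[where S = S]) (auto intro: coeff_hom_poly_in_var coeff_hom_const_poly simp: poly_in_var_pvar)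

lemma vars_in_coeff_poly_in_var:
  assumes "vars_in (insert k S) p"
  shows "vars_in (S - {k}) (coeff (poly_in_var k p) i)"
proof -
  let ?R = "{P. \<forall>i. vars_in (S - {k}) (coeff P i)}"
  have "poly_in_var k p \<in> ?R"
    unfolding poly_in_var_def
    by (rule ev_closed[OF coeff_hom_const_poly_mconst assms])
      (auto simp: coeff_pCons coeff_mult split: nat.split)
  then show ?thesis by auto
qed

lemma degree_poly_in_var_0_imp:
  assumes "degree (poly_in_var k p) = 0"
  shows "vars_in (UNIV - {k}) p"
proof -
  obtain c where c: "poly_in_var k p = [:c:]" using degree_eq_zeroE[OF assms] by blast
  then have "p = coeff (poly_in_var k p) 0" using poly_poly_in_var[of k p] by simp
  then show ?thesis using vars_in_coeff_poly_in_var[of k UNIV p 0] by simp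
qed

lemma vars_inI: "(\<And>k. k \<notin> S \<Longrightarrow> vars_in (UNIV - {k}) p) \<Longrightarrow> vars_in S p"
  unfolding vars_in_def by blast

lemma degree_poly_in_var_mult:
  fixes p q :: "('i::linorder, 'a::idom) mpoly"
  shows "p \<noteq> 0 \<Longrightarrow> q \<noteq> 0 \<Longrightarrow> degree (poly_in_var k (p * q)) = degree (poly_in_var k p) + degree (poly_in_var k q)"
  by (simp add: poly_in_var_hom degree_mult_eq)

lemma tdeg_mult:
  fixes p q :: "('i::linorder, 'a::idom) mpoly"
  shows "p \<noteq> 0 \<Longrightarrow> q \<noteq> 0 \<Longrightarrow> tdeg (p * q) = tdeg p + tdeg q"
  by (simp add: scaling_poly_hom degree_mult_eq)

text \<open>Degrees in each single variable add up, so no variable can cancel in a product.\<close>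

lemma vars_in_factor:
  fixes p q :: "('i::linorder, 'a::idom) mpoly"
  assumes "vars_in S (p * q)" "p \<noteq> 0" "q \<noteq> 0"
  shows "vars_in S p"
proof (rule vars_inI)
  fix k assume "k \<notin> S"
  then have "degree (poly_in_var k (p * q)) = 0"
    using poly_in_var_const[OF _ assms(1)] by simp
  then show "vars_in (UNIV - {k}) p"
    using assms by (intro degree_poly_in_var_0_imp) (simp add: degree_poly_in_var_mult)
qed

lemma vars_in_empty_imp:
  fixes p :: "('i, 'a::comm_ring_1) mpoly"
  assumes "vars_in {} p"
  shows "\<exists>c. p = mconst c"
  using ev_cong[OF coeff_hom_mconst assms, of pvar "\<lambda>i. mconst 0"]
    hom_ev[OF coeff_hom_id coeff_hom_mconst, of "\<lambda>_. 0" p]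
  by (metis ev_mconst_pvar empty_iff)

lemma tdeg_0_imp:
  assumes "tdeg p = 0"
  shows "\<exists>c. p = mconst c"
proof -
  obtain c where c: "scaling_poly p = [:c:]" using degree_eq_zeroE[OF assms] by blast
  \<comment> \<open>If p(t x) does not depend on t, its values at t = 1 and t = 0 agree, and the
    latter is the constant term.\<close>
  then have "p = poly (scaling_poly p) 0" using poly_scaling_poly_1[of p] by simp
  also have "\<dots> = ev mconst (\<lambda>i. mconst 0) p"
    by (simp add: scaling_poly_def hom_ev[OF coeff_hom_const_poly_mconst coeff_hom_poly])
  also have "\<dots> = mconst (ev (\<lambda>x. x) (\<lambda>_. 0) p)"
    by (rule hom_ev[OF coeff_hom_id coeff_hom_mconst, symmetric])
  finally show ?thesis by blast
qed

lemma is_unit_mpoly_iff: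
  fixes p :: "('i::linorder, 'a::field) mpoly"
  shows "p dvd 1 \<longleftrightarrow> p \<noteq> 0 \<and> tdeg p = 0"
proof
  assume "p dvd 1"
  then obtain q where q: "1 = p * q" by (elim dvdE)
  then have "p \<noteq> 0" "q \<noteq> 0" by auto
  then show "p \<noteq> 0 \<and> tdeg p = 0"
    using tdeg_mult[of p q] by (simp add: q[symmetric])
next
  assume p: "p \<noteq> 0 \<and> tdeg p = 0"
  then obtain c where c: "p = mconst c" using tdeg_0_imp by blast
  then have "p * mconst (inverse c) = 1"
    using p by (simp flip: mconst_mult)
  then show "p dvd 1" by (metis dvd_triv_left)
qed

text \<open>A non-unit divisor of least total degree is irreducible, because degrees add and the
  units are the nonzero elements of degree 0.\<close>

lemma irreducible_factor_exists:
  fixes c :: "('i::linorder, 'a::field) mpoly"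
  assumes "c \<noteq> 0" "\<not> c dvd 1"
  shows "\<exists>p. irreducible p \<and> p dvd c"
proof -
  define P where "P p \<longleftrightarrow> p dvd c \<and> \<not> p dvd 1" for p
  have "P c" using assms by (simp add: P_def)
  then obtain p where p: "P p" and min: "\<And>q. P q \<Longrightarrow> tdeg p \<le> tdeg q"
    using ex_has_least_nat[of P c tdeg] by blast
  have "p \<noteq> 0" using p assms by (auto simp: P_def)
  have "irreducible p"
  proof (rule irreducibleI)
    fix a b assume ab: "p = a * b"
    show "a dvd 1 \<or> b dvd 1"
    proof (rule ccontr)
      assume *: "\<not> (a dvd 1 \<or> b dvd 1)"
      have "P a" using p ab * unfolding P_def by (metis dvd_mult_left)
      then have "tdeg p \<le> tdeg a" by (rule min)
      moreover have "a \<noteq> 0" "b \<noteq> 0" using \<open>p \<noteq> 0\<close> ab by auto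
      ultimately have "tdeg b = 0" using tdeg_mult ab by fastforce
      then show False using * is_unit_mpoly_iff \<open>b \<noteq> 0\<close> by blast
    qed
  qed (use p \<open>p \<noteq> 0\<close> in \<open>auto simp: P_def\<close>)
  then show ?thesis using p by (auto simp: P_def)
qed

section \<open>Pseudo-division and primality of irreducibles, one variable at a time\<close>

lemma diff_eq_0_or_degree_less:
  fixes A B :: "'a::ab_group_add poly"
  assumes "degree A = degree B" "lead_coeff A = lead_coeff B"
  shows "A - B = 0 \<or> degree (A - B) < degree A"
  by (rule eq_zero_or_degree_less) (use assms in \<open>auto intro: degree_diff_le\<close>)

lemma poly_in_var_lead_coeff: "poly_in_var k (lead_coeff (poly_in_var k p)) = [:lead_coeff (poly_in_var k p):]"
  using vars_in_coeff_poly_in_var[of k UNIV p] by (intro poly_in_var_const[of k "UNIV - {k}"]) auto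

lemma poly_in_var_monom: "poly_in_var k (lead_coeff (poly_in_var k p) * pvar k ^ e) = monom (lead_coeff (poly_in_var k p)) e"
  by (simp add: poly_in_var_hom poly_in_var_lead_coeff poly_in_var_pvar monom_altdef)

text \<open>Division with remainder in x_k over the field K(S), with denominators cleared: instead
  of dividing by the leading coefficient of \<open>b\<close>, multiply \<open>a\<close> by it. The
  factor \<open>c\<close> collects these coefficients.\<close>

lemma pseudo_division:
  fixes a b :: "('i::linorder, 'a::field) mpoly"
  assumes "k \<notin> S" "vars_in (insert k S) a" "vars_in (insert k S) b" "b \<noteq> 0"
  shows "\<exists>c q r. c \<noteq> 0 \<and> vars_in S c \<and> vars_in (insert k S) q \<and> vars_in (insert k S) r \<and>
    c * a = q * b + r \<and> (r = 0 \<or> degree (poly_in_var k r) < degree (poly_in_var k b))"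
  using assms(2)
proof (induction "degree (poly_in_var k a)" arbitrary: a rule: less_induct)
  case less
  let ?d = "\<lambda>p. degree (poly_in_var k p)" and ?l = "\<lambda>p. lead_coeff (poly_in_var k p)"
  have vl: "vars_in S (?l p)" if "vars_in (insert k S) p" for p :: "('i, 'a) mpoly"
    using vars_in_coeff_poly_in_var[OF that] assms(1) by simp
  have vl': "vars_in (insert k S) (?l p)" if "vars_in (insert k S) p" for p :: "('i, 'a) mpoly"
    using vl[OF that] by (rule vars_in_mono) auto
  show ?case
  proof (cases "a = 0 \<or> ?d a < ?d b")
    case True
    then show ?thesis using less.prems
      by (intro exI[of _ 1] exI[of _ 0] exI[of _ a]) auto
  next
    case False
    define q where "q = ?l a * pvar k ^ (?d a - ?d b)"
    define a' where "a' = ?l b * a - q * b"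
    have q: "vars_in (insert k S) q" using vl'[OF less.prems] by (simp add: q_def)
    have a': "vars_in (insert k S) a'" using q less.prems assms(3) vl' by (simp add: a'_def)
    have lb: "?l b \<noteq> 0" "vars_in S (?l b)" using assms(3,4) vl by auto
    define M where "M = monom (?l a) (?d a - ?d b) * poly_in_var k b"
    have "poly_in_var k a' = smult (?l b) (poly_in_var k a) - M"
      using poly_in_var_monom[of k a "?d a - ?d b"]
      by (simp add: a'_def M_def poly_in_var_hom(2,3) poly_in_var_lead_coeff flip: q_def)
    moreover have "degree M = ?d a"
    proof -
      have "?l a \<noteq> 0" using False by simp
      then have m: "degree (monom (?l a) (?d a - ?d b)) = ?d a - ?d b" "monom (?l a) (?d a - ?d b) \<noteq> 0"
        by (simp_all add: degree_monom_eq monom_eq_0_iff del: leading_coeff_0_iff)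
      have "poly_in_var k b \<noteq> 0" using assms(4) by simp
      then have "degree M = ?d a - ?d b + ?d b"
        unfolding M_def using m by (metis degree_mult_eq)
      then show ?thesis using False by linarith
    qed
    moreover have "lead_coeff M = ?l a * ?l b"
      unfolding M_def lead_coeff_mult lead_coeff_monom ..
    ultimately have "poly_in_var k a' = 0 \<or> ?d a' < ?d a"
      using diff_eq_0_or_degree_less[of "smult (?l b) (poly_in_var k a)" M] lb by (simp add: mult.commute)
    then consider "a' = 0" | "?d a' < ?d a" by auto
    then show ?thesis
    proof cases
      case 1
      then show ?thesis using lb q
        by (intro exI[of _ "?l b"] exI[of _ q] exI[of _ 0]) (auto simp: a'_def)
    next
      case 2
      then obtain c q' r where *: "c \<noteq> 0" "vars_in S c" "vars_in (insert k S) q'" "vars_in (insert k S) r"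
        "c * a' = q' * b + r" "r = 0 \<or> ?d r < ?d b"
        using less.hyps[OF _ a'] by blast
      have "vars_in (insert k S) c" using *(2) by (rule vars_in_mono) auto
      then show ?thesis using * lb q
        by (intro exI[of _ "c * ?l b"] exI[of _ "q' + c * q"] exI[of _ r]) (auto simp: a'_def algebra_simps)
    qed
  qed
qed

text \<open>The part of unique factorization that is needed for K[S]. Irreducibility and
  divisibility refer to the full ring, which is harmless because by \<open>vars_in_factor\<close>
  the factors of a nonzero element of K[S] stay in K[S]. The \<open>itself\<close> argument fixes
  the coefficient field, which \<open>S\<close> does not determine.\<close>

definition irreducibles_prime :: "'a::field itself \<Rightarrow> 'i::linorder set \<Rightarrow> bool" where
  "irreducibles_prime _ S \<longleftrightarrow> (\<forall>f g h :: ('i, 'a) mpoly. vars_in S f \<longrightarrow> irreducible f \<longrightarrow>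
     vars_in S g \<longrightarrow> vars_in S h \<longrightarrow> f dvd g * h \<longrightarrow> f dvd g \<or> f dvd h)"

lemma lift_prime:
  fixes p g h :: "('i::linorder, 'a::field) mpoly"
  assumes S: "irreducibles_prime TYPE('a) S" "k \<notin> S" and p: "vars_in S p" "irreducible p"
    and "vars_in (insert k S) g" "vars_in (insert k S) h" "p dvd g * h"
  shows "p dvd g \<or> p dvd h"
  using assms(5-)
proof (induction "degree (poly_in_var k g) + degree (poly_in_var k h)" arbitrary: g h rule: less_induct)
  case less
  let ?d = "\<lambda>p. degree (poly_in_var k p)" and ?l = "\<lambda>p. lead_coeff (poly_in_var k p)"
  \<comment> \<open>The induction hypothesis is passed in as the assumption \<open>IH\<close> so
    that the same reduction serves both factors, with their roles exchanged.\<close>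
  have red: "p dvd g \<or> p dvd h"
    if gh: "vars_in (insert k S) g" "vars_in (insert k S) h" "p dvd g * h"
      and IH: "\<And>g'. ?d g' < ?d g \<Longrightarrow> vars_in (insert k S) g' \<Longrightarrow> p dvd g' * h \<Longrightarrow> p dvd g' \<or> p dvd h"
      and l: "p dvd ?l g" for g h
  proof -
    define g' where "g' = g - ?l g * pvar k ^ ?d g"
    have v: "vars_in (insert k S) (?l g)"
      using vars_in_coeff_poly_in_var[OF gh(1)] by (rule vars_in_mono) auto
    have g': "vars_in (insert k S) g'" using gh v by (simp add: g'_def)
    have *: "p dvd g' \<longleftrightarrow> p dvd g"
      using l unfolding g'_def by (metis diff_add_cancel dvd_add_left_iff dvd_mult2)
    have "p dvd g' * h"
      using l gh(3) unfolding g'_def by (simp add: left_diff_distrib dvd_mult2)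
    moreover have "poly_in_var k g' = 0 \<or> ?d g' < ?d g"
      unfolding g'_def poly_in_var_hom(3) poly_in_var_monom
      by (cases "g = 0"; intro diff_eq_0_or_degree_less) (auto simp: degree_monom_eq)
    ultimately show ?thesis using IH[of g'] g' * by auto
  qed
  obtain q where q: "g * h = p * q" using less.prems(3) by (elim dvdE)
  have "?l g * ?l h = ?l (g * h)" by (simp add: poly_in_var_hom lead_coeff_mult)
  also have "\<dots> = p * ?l q"
    unfolding q poly_in_var_hom(2) poly_in_var_const[OF S(2) p(1)] lead_coeff_mult by simp
  finally have "p dvd ?l g * ?l h" by simp
  moreover have "vars_in S (?l g)" "vars_in S (?l h)"
    using less.prems vars_in_coeff_poly_in_var S(2) by fastforce+
  ultimately have "p dvd ?l g \<or> p dvd ?l h"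
    using S(1) p unfolding irreducibles_prime_def by blast
  then show ?case
  proof
    assume "p dvd ?l g"
    then show ?thesis
      using less.prems by (intro red[of g h] less.hyps[of _ h]) auto
  next
    assume "p dvd ?l h"
    then have "p dvd h \<or> p dvd g"
      using less.prems by (intro red[of h g] less.hyps[of _ g]) (auto simp: mult.commute)
    then show ?thesis by blast
  qed
qed

lemma mult_unitE:
  fixes c :: "'a::comm_ring_1"
  assumes "c dvd 1" obtains u where "u * c = 1"
  using assms by (metis dvdE mult.commute)

text \<open>An irreducible \<open>f\<close> that involves x_k is primitive. A prime factor
  \<open>p\<close> of \<open>c\<close> divides f w; it cannot divide \<open>f\<close>, for then
  \<open>f\<close> would be \<open>p\<close> times a unit and free of x_k, so it cancels from both
  sides.\<close>

lemma dvd_cancel_coeff: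
  fixes f g c :: "('i::linorder, 'a::field) mpoly"
  assumes S: "irreducibles_prime TYPE('a) S" "k \<notin> S"
    and f: "irreducible f" "vars_in (insert k S) f" "degree (poly_in_var k f) > 0"
    and g: "vars_in (insert k S) g"
    and c: "vars_in S c" "c \<noteq> 0" "f dvd c * g"
  shows "f dvd g"
  using c
proof (induction "tdeg c" arbitrary: c rule: less_induct)
  case less
  show ?case
  proof (cases "c dvd 1 \<or> g = 0")
    case True
    then show ?thesis
    proof
      assume "c dvd 1"
      then obtain u where "u * c = 1" by (rule mult_unitE)
      then have "g = u * (c * g)" by (simp flip: mult.assoc)
      then show ?thesis using less.prems(3) by (metis dvd_mult)
    qed auto
  next
    case False
    then obtain p c0 where p: "irreducible p" "c = p * c0"
      using irreducible_factor_exists[of c] less.prems by (metis dvdE)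
    obtain w where w: "c * g = f * w" using less.prems(3) by (elim dvdE)
    have nz: "p \<noteq> 0" "c0 \<noteq> 0" "w \<noteq> 0" "f \<noteq> 0" using p w less.prems False by auto
    have vp: "vars_in S p" "vars_in S c0"
      using vars_in_factor[of S p c0] vars_in_factor[of S c0 p] p less.prems nz by (auto simp: mult.commute)
    have vc: "vars_in (insert k S) c" using less.prems(1) by (rule vars_in_mono) auto
    have vw: "vars_in (insert k S) w"
      by (rule vars_in_factor[of _ w f]) (use vc g w nz in \<open>auto simp: mult.commute[of w f] simp flip: w\<close>)
    have "p dvd f * w" using w p by (metis dvd_triv_left mult.assoc)
    then have "p dvd f \<or> p dvd w" using lift_prime[OF S vp(1) p(1) f(2) vw] by blast
    then show ?thesis
    proof
      assume "p dvd f"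
      then obtain s where s: "f = p * s" by (elim dvdE)
      then have "s dvd 1" using f(1) p(1) unfolding irreducible_def by blast
      then have "s \<noteq> 0" "tdeg s = 0" by (auto simp: is_unit_mpoly_iff)
      then obtain a where "s = mconst a" using tdeg_0_imp by blast
      then have "vars_in S f" using s vp by simp
      then show ?thesis using f(3) poly_in_var_const[OF S(2), of f] by simp
    next
      assume "p dvd w"
      then obtain w' where "w = p * w'" by (elim dvdE)
      then have "p * (c0 * g) = p * (f * w')" using w p by (simp add: mult_ac)
      then have "f dvd c0 * g" using nz by simp
      moreover have "tdeg c0 < tdeg c"
        using tdeg_mult[OF nz(1,2)] p is_unit_mpoly_iff[of p] nz unfolding irreducible_def by simp
      ultimately show ?thesis using less.hyps[of c0] vp nz by blast
    qed
  qed
qed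

text \<open>Turns a factorization of \<open>f\<close> over K(S) into one over K[S]: each prime
  factor of \<open>c\<close> divides \<open>q\<close> or \<open>b\<close> and is moved into
  \<open>c1\<close> or \<open>c2\<close> accordingly.\<close>

lemma split_coeff_factor:
  fixes f q b c :: "('i::linorder, 'a::field) mpoly"
  assumes S: "irreducibles_prime TYPE('a) S" "k \<notin> S"
    and "vars_in S c" "c \<noteq> 0" "c * f = q * b" "f \<noteq> 0" "vars_in (insert k S) q" "vars_in (insert k S) b"
  shows "\<exists>c1 c2 q' b'. vars_in S c1 \<and> vars_in S c2 \<and> q = c1 * q' \<and> b = c2 * b' \<and> f = q' * b'"
  using assms(3-)
proof (induction "tdeg c" arbitrary: c q b rule: less_induct)
  case less
  show ?case
  proof (cases "c dvd 1")
    case True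
    then obtain u where u: "u * c = 1" by (rule mult_unitE)
    then have "f = u * (c * f)" by (simp flip: mult.assoc)
    then have "f = (u * q) * b" using less.prems by (simp add: mult.assoc)
    moreover have "q = c * (u * q)" using u by (metis mult.assoc mult.commute mult.left_neutral)
    ultimately show ?thesis using less.prems(1)
      by (intro exI[of _ c] exI[of _ 1] exI[of _ "u * q"] exI[of _ b]) auto
  next
    case False
    then obtain p c0 where p: "irreducible p" "c = p * c0"
      using irreducible_factor_exists[of c] less.prems by (metis dvdE)
    have nz: "p \<noteq> 0" "c0 \<noteq> 0" "q \<noteq> 0" "b \<noteq> 0" using p less.prems by auto
    have vp: "vars_in S p" "vars_in S c0"
      using vars_in_factor[of S p c0] vars_in_factor[of S c0 p] p less.prems nz by (auto simp: mult.commute)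
    have lt: "tdeg c0 < tdeg c"
      using tdeg_mult[OF nz(1,2)] p is_unit_mpoly_iff[of p] nz unfolding irreducible_def by simp
    have "p dvd q * b" using less.prems(3) p by (metis dvd_triv_left mult.assoc)
    then have "p dvd q \<or> p dvd b"
      using lift_prime[OF S vp(1) p(1)] less.prems by blast
    then show ?thesis
    proof
      assume "p dvd q"
      then obtain q0 where q0: "q = p * q0" by (elim dvdE)
      have "p * (c0 * f) = p * (q0 * b)" using less.prems(3) p q0 by (simp add: mult_ac)
      then have eq: "c0 * f = q0 * b" using nz by simp
      have "vars_in (insert k S) q0"
        by (rule vars_in_factor[of _ q0 p]) (use less.prems q0 nz in \<open>auto simp: mult.commute\<close>)
      then obtain c1 c2 q' b' where "vars_in S c1" "vars_in S c2" "q0 = c1 * q'" "b = c2 * b'" "f = q' * b'"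
        using less.hyps[OF lt vp(2) nz(2) eq] less.prems by blast
      then show ?thesis using vp q0
        by (intro exI[of _ "p * c1"] exI[of _ c2] exI[of _ q'] exI[of _ b']) (auto simp: mult_ac)
    next
      assume "p dvd b"
      then obtain b0 where b0: "b = p * b0" by (elim dvdE)
      have "p * (c0 * f) = p * (q * b0)" using less.prems(3) p b0 by (simp add: mult_ac)
      then have eq: "c0 * f = q * b0" using nz by simp
      have "vars_in (insert k S) b0"
        by (rule vars_in_factor[of _ b0 p]) (use less.prems b0 nz in \<open>auto simp: mult.commute\<close>)
      then obtain c1 c2 q' b' where "vars_in S c1" "vars_in S c2" "q = c1 * q'" "b0 = c2 * b'" "f = q' * b'"
        using less.hyps[OF lt vp(2) nz(2) eq] less.prems by blast
      then show ?thesis using vp b0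
        by (intro exI[of _ c1] exI[of _ "p * c2"] exI[of _ q'] exI[of _ b']) (auto simp: mult_ac)
    qed
  qed
qed

text \<open>Bezout's identity over K(S) with denominators cleared. A combination \<open>b\<close> of
  \<open>f\<close> and \<open>g\<close> of least degree in x_k divides both up to coefficients. As
  \<open>f\<close> is irreducible, \<open>b\<close> is, up to a factor free of x_k, either an
  associate of \<open>f\<close>, which would force \<open>f\<close> to divide \<open>g\<close>, or a
  unit.\<close>

lemma eliminate_variable:
  fixes f g :: "('i::linorder, 'a::field) mpoly"
  assumes S: "irreducibles_prime TYPE('a) S" "k \<notin> S"
    and f: "irreducible f" "vars_in (insert k S) f" "degree (poly_in_var k f) > 0"
    and g: "vars_in (insert k S) g" "\<not> f dvd g"
  shows "\<exists>u v. vars_in (insert k S) u \<and> vars_in (insert k S) v \<and>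
    u * f + v * g \<noteq> 0 \<and> vars_in S (u * f + v * g)"
proof -
  define I where "I b \<longleftrightarrow> b \<noteq> 0 \<and> vars_in (insert k S) b \<and>
    (\<exists>u v. vars_in (insert k S) u \<and> vars_in (insert k S) v \<and> b = u * f + v * g)" for b
  have f0: "f \<noteq> 0" using f(1) by auto
  have "f = 1 * f + 0 * g" by simp
  then have If: "I f" using f f0 unfolding I_def by (metis vars_in_0 vars_in_1)
  then obtain b where b: "I b" and min: "\<And>b'. I b' \<Longrightarrow> degree (poly_in_var k b) \<le> degree (poly_in_var k b')"
    using ex_has_least_nat[of I f "\<lambda>b. degree (poly_in_var k b)"] by blast
  then obtain u v where uv: "vars_in (insert k S) u" "vars_in (insert k S) v" "b = u * f + v * g"
    and b': "b \<noteq> 0" "vars_in (insert k S) b" by (auto simp: I_def)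
  \<comment> \<open>The remainder is again a combination of \<open>f\<close> and \<open>g\<close>,
    so minimality of \<open>b\<close> makes it zero.\<close>
  have div: "\<exists>c q. c \<noteq> 0 \<and> vars_in S c \<and> vars_in (insert k S) q \<and> c * a = q * b"
    if a: "vars_in (insert k S) a" and lin: "vars_in (insert k S) s" "vars_in (insert k S) t" "a = s * f + t * g" for a s t
  proof -
    obtain c q r where r: "c \<noteq> 0" "vars_in S c" "vars_in (insert k S) q" "vars_in (insert k S) r"
      "c * a = q * b + r" "r = 0 \<or> degree (poly_in_var k r) < degree (poly_in_var k b)"
      using pseudo_division[OF S(2) a b'(2,1)] by blast
    have vc: "vars_in (insert k S) c" using r(2) by (rule vars_in_mono) auto
    have "r = c * (s * f + t * g) - q * (u * f + v * g)" using r(5) lin(3) uv(3) by (simp add: algebra_simps)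
    then have "r = (c * s - q * u) * f + (c * t - q * v) * g" by (simp add: algebra_simps)
    moreover have "vars_in (insert k S) (c * s - q * u)" "vars_in (insert k S) (c * t - q * v)"
      using vc lin uv r by auto
    ultimately have "r = 0" using r(4,6) min[of r] unfolding I_def by fastforce
    then show ?thesis using r by auto
  qed
  obtain c q where c: "c \<noteq> 0" "vars_in S c" "vars_in (insert k S) q" "c * f = q * b"
    using div[of f 1 0] f by auto
  obtain c1 c2 q' b' where s: "vars_in S c1" "vars_in S c2" "q = c1 * q'" "b = c2 * b'" "f = q' * b'"
    using split_coeff_factor[OF S c(2,1,4) f0 c(3) b'(2)] by blast
  consider "q' dvd 1" | "b' dvd 1" using f(1) s(5) unfolding irreducible_def by blast
  then show ?thesis
  proof cases
    case 1
    then obtain w where w: "w * q' = 1" by (rule mult_unitE)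
    have bf: "b' = w * f" using s(5) w by (simp flip: mult.assoc)
    obtain c' r where c': "c' \<noteq> 0" "vars_in S c'" "c' * g = r * b"
      using div[of g 0 1] g by auto
    have "c' * g = f * (r * c2 * w)" using c' s(4) bf by (simp add: mult_ac)
    then have "f dvd c' * g" by simp
    then have "f dvd g" using dvd_cancel_coeff[OF S f g(1) c'(2,1)] by blast
    then show ?thesis using g by blast
  next
    case 2
    then obtain a where "b' = mconst a" using tdeg_0_imp by (auto simp: is_unit_mpoly_iff)
    then have "vars_in S b" using s by simp
    then show ?thesis using uv b' by blast
  qed
qed

text \<open>If \<open>f\<close> involves x_k and does not divide \<open>g\<close>, then it divides
  \<open>h\<close> times the nonzero combination of \<open>f\<close> and \<open>g\<close> free of
  x_k, and this coefficient can be cancelled.\<close>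

lemma irreducibles_prime_insert:
  assumes S: "irreducibles_prime TYPE('a::field) S" "k \<notin> S"
  shows "irreducibles_prime TYPE('a) (insert k S)"
  unfolding irreducibles_prime_def
proof (intro allI impI)
  fix f g h :: "('b, 'a) mpoly"
  assume f: "vars_in (insert k S) f" "irreducible f" and gh: "vars_in (insert k S) g" "vars_in (insert k S) h"
    and dvd: "f dvd g * h"
  show "f dvd g \<or> f dvd h"
  proof (cases "degree (poly_in_var k f) = 0")
    case True
    then have "vars_in (UNIV - {k}) f" by (rule degree_poly_in_var_0_imp)
    with f(1) have "vars_in (insert k S \<inter> (UNIV - {k})) f" by (rule vars_in_Int)
    then have "vars_in S f" by (rule vars_in_mono) auto
    then show ?thesis using lift_prime[OF S _ f(2) gh dvd] by blast
  next
    case False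
    show ?thesis
    proof (cases "f dvd g")
      case False': False
      then obtain u v where b: "u * f + v * g \<noteq> 0" "vars_in S (u * f + v * g)"
        using eliminate_variable[OF S f(2,1) _ gh(1)] False False' by auto
      have "(u * f + v * g) * h = f * (u * h) + v * (g * h)" by (simp add: algebra_simps)
      then have "f dvd (u * f + v * g) * h" using dvd by simp
      then show ?thesis using dvd_cancel_coeff[OF S f(2,1) _ gh(2) b(2,1)] False by simp
    qed simp
  qed
qed

lemma irreducibles_prime_finite: "finite S \<Longrightarrow> irreducibles_prime TYPE('a::field) S"
proof (induction S rule: finite_induct)
  case empty
  have "\<not> irreducible f" if f: "vars_in {} f" for f :: "('b, 'a) mpoly"
  proof
    assume irr: "irreducible f"
    obtain c where "f = mconst c" using vars_in_empty_imp[OF f] by blast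
    then have "f dvd 1 \<or> f = 0" by (simp add: is_unit_mpoly_iff)
    then show False using irr by (auto simp: irreducible_def)
  qed
  then show ?case unfolding irreducibles_prime_def by blast
qed (rule irreducibles_prime_insert)

section \<open>Algebraic dependence by counting monomials\<close>

text \<open>Bounding every exponent separately makes the admissible monomials a box, whose size is
  an exact power.\<close>

definition exponents_le :: "nat \<Rightarrow> ('i, 'a::zero) mpoly \<Rightarrow> bool" where
  "exponents_le D p \<longleftrightarrow> (\<forall>m\<in>Poly_Mapping.keys p. \<forall>i. Poly_Mapping.lookup m i \<le> D)"

lemma exponents_le_mono: "exponents_le D p \<Longrightarrow> D \<le> E \<Longrightarrow> exponents_le E p"
  unfolding exponents_le_def by (meson order_trans)

lemma exponents_le_exists: "\<exists>D. exponents_le D (p :: ('i, 'a::zero) mpoly)"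
proof -
  let ?D = "\<Sum>m\<in>Poly_Mapping.keys p. \<Sum>i\<in>Poly_Mapping.keys m. Poly_Mapping.lookup m i"
  have "Poly_Mapping.lookup m i \<le> ?D" if m: "m \<in> Poly_Mapping.keys p" for m i
  proof (cases "i \<in> Poly_Mapping.keys m")
    case True
    have "Poly_Mapping.lookup m i \<le> (\<Sum>i\<in>Poly_Mapping.keys m. Poly_Mapping.lookup m i)"
      using True by (intro member_le_sum) auto
    also have "\<dots> \<le> ?D"
      using m by (intro member_le_sum[where f = "\<lambda>m. \<Sum>i\<in>Poly_Mapping.keys m. Poly_Mapping.lookup m i"]) auto
    finally show ?thesis .
  qed (simp add: in_keys_iff)
  then show ?thesis unfolding exponents_le_def by blast
qed

lemma exponents_le_1 [simp]: "exponents_le D 1"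
  by (simp add: exponents_le_def)

lemma exponents_le_mult:
  assumes "exponents_le D p" "exponents_le E (q :: ('i, 'a::comm_semiring_1) mpoly)"
  shows "exponents_le (D + E) (p * q)"
  unfolding exponents_le_def
proof (intro ballI allI)
  fix m i assume "m \<in> Poly_Mapping.keys (p * q)"
  then obtain a b where "m = a + b" "a \<in> Poly_Mapping.keys p" "b \<in> Poly_Mapping.keys q"
    using keys_mult[of p q] by blast
  then show "Poly_Mapping.lookup m i \<le> D + E"
    using assms by (simp add: exponents_le_def lookup_add add_mono)
qed

lemma exponents_le_power: "exponents_le D (p :: ('i, 'a::comm_semiring_1) mpoly) \<Longrightarrow> exponents_le (k * D) (p ^ k)"
  by (induction k) (auto intro: exponents_le_mult)

lemma exponents_le_prod:
  assumes "finite A" "\<And>a. a \<in> A \<Longrightarrow> exponents_le D (f a :: ('i, 'a::comm_semiring_1) mpoly)"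
  shows "exponents_le (card A * D) (prod f A)"
  using assms by (induction A) (auto intro: exponents_le_mult)

lemma card_exponents:
  fixes I :: "'i set"
  assumes "finite I" "N > 0"
  defines "A \<equiv> {m :: 'i \<Rightarrow>\<^sub>0 nat. Poly_Mapping.keys m \<subseteq> I \<and> (\<forall>i. Poly_Mapping.lookup m i < N)}"
  shows "finite A" "card A = N ^ card I"
proof -
  have "bij_betw (\<lambda>m. restrict (Poly_Mapping.lookup m) I) A (PiE I (\<lambda>_. {..<N}))"
  proof (rule bij_betw_imageI)
    show "inj_on (\<lambda>m. restrict (Poly_Mapping.lookup m) I) A"
    proof (rule inj_onI, rule poly_mapping_eqI)
      fix m m' k
      assume *: "m \<in> A" "m' \<in> A" "restrict (Poly_Mapping.lookup m) I = restrict (Poly_Mapping.lookup m') I"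
      show "Poly_Mapping.lookup m k = Poly_Mapping.lookup m' k"
      proof (cases "k \<in> I")
        case True
        then show ?thesis using fun_cong[OF *(3), of k] by simp
      next
        case False
        then have "k \<notin> Poly_Mapping.keys m" "k \<notin> Poly_Mapping.keys m'" using * by (auto simp: A_def)
        then show ?thesis by (simp add: in_keys_iff)
      qed
    qed
    show "(\<lambda>m. restrict (Poly_Mapping.lookup m) I) ` A = PiE I (\<lambda>_. {..<N})"
    proof
      show "PiE I (\<lambda>_. {..<N}) \<subseteq> (\<lambda>m. restrict (Poly_Mapping.lookup m) I) ` A"
      proof
        fix f assume f: "f \<in> PiE I (\<lambda>_. {..<N})"
        define m where "m = (\<Sum>i\<in>I. Poly_Mapping.single i (f i))"
        have l: "Poly_Mapping.lookup m k = (if k \<in> I then f k else 0)" for k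
          using assms(1) by (simp add: m_def lookup_sum lookup_single when_def)
        have "m \<in> A" using f assms(2) by (auto simp: A_def l in_keys_iff)
        moreover have "restrict (Poly_Mapping.lookup m) I = f" using f by (auto simp: fun_eq_iff l)
        ultimately show "f \<in> (\<lambda>m. restrict (Poly_Mapping.lookup m) I) ` A" by blast
      qed
    qed (auto simp: A_def)
  qed
  from bij_betw_finite[OF this] bij_betw_same_card[OF this]
  show "finite A" "card A = N ^ card I"
    using assms(1) by (auto simp: card_PiE finite_PiE)
qed

lemma vector_space_mpoly: "vector_space (\<lambda>a p. mconst a * p :: ('i, 'a::field) mpoly)"
  by unfold_locales (auto simp: mconst_add mconst_mult algebra_simps)

lemma dependent_family:
  fixes P :: "'b \<Rightarrow> ('i, 'a::field) mpoly"
  assumes "finite A" "finite M" "card M < card A"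
    and "\<And>x. x \<in> A \<Longrightarrow> Poly_Mapping.keys (P x) \<subseteq> M"
  shows "\<exists>c. (\<exists>x\<in>A. c x \<noteq> 0) \<and> (\<Sum>x\<in>A. mconst (c x) * P x) = 0"
proof -
  interpret vs: vector_space "\<lambda>a p. mconst a * p :: ('i, 'a) mpoly" by (rule vector_space_mpoly)
  show ?thesis
  proof (cases "inj_on P A")
    \<comment> \<open>A set forgets repetitions, so two equal members are turned into a relation by
      hand before linear dependence of sets applies.\<close>
    case False
    then obtain x y where xy: "x \<in> A" "y \<in> A" "x \<noteq> y" "P x = P y" by (auto simp: inj_on_def)
    define c where "c z = (if z = x then 1 else if z = y then -1 else 0 :: 'a)" for z
    have "(\<Sum>z\<in>A. mconst (c z) * P z) = (\<Sum>z\<in>{x, y}. mconst (c z) * P z)"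
      using assms(1) xy by (intro sum.mono_neutral_right) (auto simp: c_def)
    also have "\<dots> = 0"
      using xy by (simp add: c_def coeff_hom.hom_uminus[OF coeff_hom_mconst])
    finally show ?thesis using xy by (intro exI[of _ c]) (auto simp: c_def)
  next
    case True
    let ?t = "(\<lambda>m. Poly_Mapping.single m (1::'a)) ` M"
    have "P x \<in> vs.span ?t" if "x \<in> A" for x
    proof -
      have "P x = (\<Sum>m\<in>Poly_Mapping.keys (P x). mconst (Poly_Mapping.lookup (P x) m) * Poly_Mapping.single m 1)"
        by (subst mpoly_sum_single) (simp add: mconst_def mult_single)
      also have "\<dots> \<in> vs.span ?t"
        using assms(4)[OF that] by (intro vs.span_sum vs.span_scale vs.span_base) auto
      finally show ?thesis .
    qed
    then have "P ` A \<subseteq> vs.span ?t" by auto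
    moreover have "card ?t < card (P ` A)"
      using card_image_le[OF assms(2), of "\<lambda>m. Poly_Mapping.single m (1::'a)"] assms(3) True
      by (simp add: card_image)
    ultimately have "vs.dependent (P ` A)"
      using vs.independent_span_bound[of ?t "P ` A"] assms(2) by fastforce
    then obtain u where "\<exists>v\<in>P ` A. u v \<noteq> 0" "(\<Sum>v\<in>P ` A. mconst (u v) * v) = 0"
      using vs.dependent_finite[of "P ` A"] assms(1) by auto
    then show ?thesis
      using True by (intro exI[of _ "u \<circ> P"]) (simp add: sum.reindex)
  qed
qed

section \<open>Algebraic independence in the fraction field\<close>

definition const_fract :: "'a::idom \<Rightarrow> ('n::linorder, 'a) mpoly fract" where
  "const_fract a = to_fract (mconst a)"

lemma coeff_hom_const_fract: "coeff_hom const_fract"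
  using coeff_hom_comp[OF coeff_hom_to_fract coeff_hom_mconst] by (simp add: const_fract_def[abs_def])

lemma const_fract_0 [simp]: "const_fract 0 = 0"
  by (simp add: const_fract_def)

lemma const_fract_eq_0_iff [simp]: "const_fract a = 0 \<longleftrightarrow> a = 0"
  by (simp add: const_fract_def)

abbreviation fract_ev :: "('i \<Rightarrow> ('n::linorder, 'a::idom) mpoly fract) \<Rightarrow> ('i, 'a) mpoly \<Rightarrow> ('n, 'a) mpoly fract" where
  "fract_ev \<equiv> ev const_fract"

lemmas fract_ev_hom = coeff_hom.ev_add[OF coeff_hom_const_fract] coeff_hom.ev_mult[OF coeff_hom_const_fract]
  coeff_hom.ev_mconst[OF coeff_hom_const_fract] coeff_hom.ev_pvar[OF coeff_hom_const_fract]
  coeff_hom.ev_0[OF coeff_hom_const_fract]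

text \<open>Works with an indexed family, so that a repeated member counts as a dependence, and with
  relations whose coefficients lie in K itself rather than in its copy inside the fraction
  field.\<close>

definition alg_indep_family :: "'i set \<Rightarrow> ('i \<Rightarrow> ('n::linorder, 'a::idom) mpoly fract) \<Rightarrow> bool" where
  "alg_indep_family I f \<longleftrightarrow> (\<forall>q. vars_in I q \<longrightarrow> fract_ev f q = 0 \<longrightarrow> q = 0)"

text \<open>\<open>const_field\<close> is the injective image of K, so mapping coefficients by
  \<open>const_fract\<close> matches the relations of both kinds.\<close>

lemma alg_independent_const_field:
  fixes S :: "('n::{finite,linorder}, 'a::field) mpoly fract set"
  shows "alg_independent const_field S \<longleftrightarrow> alg_indep_family S (\<lambda>x. x)"
proof -
  have keys: "Poly_Mapping.keys (Poly_Mapping.map const_fract q) = Poly_Mapping.keys q"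
    for q :: "(('n, 'a) mpoly fract, 'a) mpoly"
    by (auto simp: in_keys_iff map.rep_eq when_def)
  have eval: "eval_self (Poly_Mapping.map const_fract q) = fract_ev (\<lambda>x. x) q"
    for q :: "(('n, 'a) mpoly fract, 'a) mpoly"
    unfolding eval_self_def ev_def keys monomial_value_def
    by (rule sum.cong) (auto simp: map.rep_eq when_def)
  have cf: "const_field = range (const_fract :: 'a \<Rightarrow> ('n, 'a) mpoly fract)"
    by (simp add: const_field_def const_fract_def)
  have "\<exists>q. p = Poly_Mapping.map const_fract q"
    if p: "Poly_Mapping.range p \<subseteq> const_field" for p :: "(('n, 'a) mpoly fract, ('n, 'a) mpoly fract) mpoly"
  proof
    have "Poly_Mapping.lookup p k \<in> range const_fract" for k
    proof (cases "k \<in> Poly_Mapping.keys p")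
      case True
      then show ?thesis using p cf by (metis in_keys_lookup_in_range subset_iff)
    next
      case False
      then show ?thesis by (simp add: in_keys_iff image_iff exI[of _ 0])
    qed
    then have "const_fract (inv_into UNIV const_fract (Poly_Mapping.lookup p k)) = Poly_Mapping.lookup p k" for k
      by (simp add: f_inv_into_f)
    then show "p = Poly_Mapping.map const_fract (Poly_Mapping.map (inv_into UNIV const_fract) p)"
      by (intro poly_mapping_eqI) (auto simp: map.rep_eq when_def, metis const_fract_0)
  qed
  moreover have "Poly_Mapping.range (Poly_Mapping.map const_fract q) \<subseteq> (const_field :: ('n, 'a) mpoly fract set)"
    for q :: "(('n, 'a) mpoly fract, 'a) mpoly"
    by (auto simp: cf range.rep_eq map.rep_eq when_def)
  moreover have "Poly_Mapping.map const_fract q = (0 :: (('n, 'a) mpoly fract, ('n, 'a) mpoly fract) mpoly) \<longleftrightarrow> q = 0"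
    for q :: "(('n, 'a) mpoly fract, 'a) mpoly"
    using keys[of q] by (metis keys_eq_empty)
  ultimately have "(\<forall>p :: (('n, 'a) mpoly fract, ('n, 'a) mpoly fract) mpoly.
      Poly_Mapping.range p \<subseteq> const_field \<longrightarrow> Q p) \<longleftrightarrow> (\<forall>q. Q (Poly_Mapping.map const_fract q))"
    and "\<And>q. Poly_Mapping.map const_fract q = (0 :: (('n, 'a) mpoly fract, ('n, 'a) mpoly fract) mpoly) \<longleftrightarrow> q = 0" for Q
    by blast+
  note * = this
  show ?thesis
    unfolding alg_independent_def alg_indep_family_def vars_in_def
    using *(1)[of "\<lambda>p. (\<forall>m\<in>Poly_Mapping.keys p. Poly_Mapping.keys m \<subseteq> S) \<longrightarrow> eval_self p = 0 \<longrightarrow> p = 0"]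
    by (simp add: eval keys *(2) imp_conjL)
qed

text \<open>With exponents below N there are N^m power products of m elements, but their numerators
  over a common denominator use only O(N^t) monomials. For t < m and large N they are linearly
  dependent, and such a dependence is a polynomial relation.\<close>

lemma alg_dependent_of_card:
  fixes f :: "'i \<Rightarrow> ('n::linorder, 'a::field) mpoly fract"
  assumes fin: "finite I" "finite T" and card: "card T < card I"
    and g: "g \<noteq> 0" "vars_in T g" and num: "\<And>i. i \<in> I \<Longrightarrow> vars_in T (num i)"
    and f: "\<And>i. i \<in> I \<Longrightarrow> f i = to_fract (num i) / to_fract g"
  shows "\<not> alg_indep_family I f"
proof -
  have "\<exists>D. \<forall>p\<in>insert g (num ` I). exponents_le D p"
  proof -
    obtain D where D: "\<And>p :: ('n, 'a) mpoly. exponents_le (D p) p" using exponents_le_exists by metis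
    have "exponents_le (\<Sum>p\<in>insert g (num ` I). D p) p" if "p \<in> insert g (num ` I)" for p
      using that fin by (intro exponents_le_mono[OF D] member_le_sum) auto
    then show ?thesis by blast
  qed
  then obtain D where D: "exponents_le D g" "\<And>i. i \<in> I \<Longrightarrow> exponents_le D (num i)" by auto
  define t where "t = card T"
  define m where "m = card I"
  \<comment> \<open>Chosen larger than (m D + 1)^t, which gives (m N D + 1)^t \<le> (m D + 1)^t N^t
    < N^(t+1) \<le> N^m.\<close>
  define N where "N = (m * D + 1) ^ t + 1"
  define A where "A = {\<alpha> :: 'i \<Rightarrow>\<^sub>0 nat. Poly_Mapping.keys \<alpha> \<subseteq> I \<and> (\<forall>i. Poly_Mapping.lookup \<alpha> i < N)}"
  define M where "M = {\<alpha> :: 'n \<Rightarrow>\<^sub>0 nat. Poly_Mapping.keys \<alpha> \<subseteq> T \<and> (\<forall>i. Poly_Mapping.lookup \<alpha> i < m * (N * D) + 1)}"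
  \<comment> \<open>The power product multiplied by g^(N m), the same denominator for all \<alpha>;
    the leftover powers of \<open>g\<close> fill each factor up to exponent N.\<close>
  define P where "P \<alpha> = (\<Prod>i\<in>I. num i ^ Poly_Mapping.lookup \<alpha> i * g ^ (N - Poly_Mapping.lookup \<alpha> i))" for \<alpha>
  have A: "finite A" "card A = N ^ m" and M: "finite M" "card M = (m * (N * D) + 1) ^ t"
    unfolding A_def M_def m_def t_def by (rule card_exponents; use fin in \<open>simp add: N_def\<close>)+
  have "m * (N * D) + 1 \<le> (m * D + 1) * N" by (simp add: N_def algebra_simps)
  then have "(m * (N * D) + 1) ^ t \<le> (m * D + 1) ^ t * N ^ t"
    by (metis power_mono power_mult_distrib le0)
  also have "\<dots> < N * N ^ t" by (simp add: N_def)
  also have "\<dots> = N ^ Suc t" by simp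
  also have "\<dots> \<le> N ^ m" using card by (intro power_increasing) (auto simp: N_def m_def t_def)
  finally have "card M < card A" using A M by simp
  moreover have "Poly_Mapping.keys (P \<alpha>) \<subseteq> M" if "\<alpha> \<in> A" for \<alpha>
  proof -
    have \<alpha>: "Poly_Mapping.lookup \<alpha> i < N" for i using that by (simp add: A_def)
    have "exponents_le (Poly_Mapping.lookup \<alpha> i * D + (N - Poly_Mapping.lookup \<alpha> i) * D)
        (num i ^ Poly_Mapping.lookup \<alpha> i * g ^ (N - Poly_Mapping.lookup \<alpha> i))" if "i \<in> I" for i
      using D that by (intro exponents_le_mult exponents_le_power) auto
    moreover have "Poly_Mapping.lookup \<alpha> i * D + (N - Poly_Mapping.lookup \<alpha> i) * D = N * D" for i
      using less_imp_le[OF \<alpha>[of i]] by (simp flip: distrib_right)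
    ultimately have "exponents_le (N * D) (num i ^ Poly_Mapping.lookup \<alpha> i * g ^ (N - Poly_Mapping.lookup \<alpha> i))" if "i \<in> I" for i
      using that by metis
    then have "exponents_le (m * (N * D)) (P \<alpha>)"
      unfolding P_def m_def by (intro exponents_le_prod fin)
    moreover have "vars_in T (P \<alpha>)"
    proof -
      have "vars_in T (\<Prod>i\<in>J. num i ^ Poly_Mapping.lookup \<alpha> i * g ^ (N - Poly_Mapping.lookup \<alpha> i))"
        if "finite J" "J \<subseteq> I" for J
        using that by (induction J) (auto simp: g num)
      then show ?thesis using fin by (simp add: P_def)
    qed
    ultimately show ?thesis unfolding exponents_le_def vars_in_def M_def by (auto simp: less_Suc_eq_le)
  qed
  ultimately obtain c where c: "\<exists>\<alpha>\<in>A. c \<alpha> \<noteq> 0" "(\<Sum>\<alpha>\<in>A. mconst (c \<alpha>) * P \<alpha>) = 0"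
    using dependent_family[OF A(1) M(1), of P] by auto
  define q where "q = (\<Sum>\<alpha>\<in>A. Poly_Mapping.single \<alpha> (c \<alpha>))"
  have "Poly_Mapping.lookup q \<alpha> = (if \<alpha> \<in> A then c \<alpha> else 0)" for \<alpha>
    using A(1) by (simp add: q_def lookup_sum lookup_single when_def)
  then have "q \<noteq> 0" using c(1) by (metis lookup_zero)
  have "vars_in I q"
    unfolding q_def by (rule vars_in_sum) (auto simp: vars_in_def A_def)
  have g0: "to_fract g \<noteq> 0" using g by simp
  have "to_fract (P \<alpha>) = to_fract g ^ (N * m) * monomial_value f \<alpha>" if "\<alpha> \<in> A" for \<alpha>
  proof -
    have hom: "to_fract (prod h J) = (\<Prod>j\<in>J. to_fract (h j))" "to_fract (p ^ k) = to_fract p ^ k"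
      for h :: "'i \<Rightarrow> ('n, 'a) mpoly" and J and p :: "('n, 'a) mpoly" and k
      using coeff_hom.hom_prod[OF coeff_hom_to_fract] coeff_hom.hom_power[OF coeff_hom_to_fract] by blast+
    have "to_fract (num i) ^ Poly_Mapping.lookup \<alpha> i * to_fract g ^ (N - Poly_Mapping.lookup \<alpha> i) =
        to_fract g ^ N * f i ^ Poly_Mapping.lookup \<alpha> i" if "i \<in> I" for i
    proof -
      have "Poly_Mapping.lookup \<alpha> i \<le> N" using \<open>\<alpha> \<in> A\<close> by (auto simp: A_def less_imp_le)
      then have "to_fract g ^ N = to_fract g ^ (N - Poly_Mapping.lookup \<alpha> i) * to_fract g ^ Poly_Mapping.lookup \<alpha> i"
        by (simp flip: power_add)
      then show ?thesis using g0 f[OF that] by (simp add: power_divide)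
    qed
    then have "to_fract (P \<alpha>) = (\<Prod>i\<in>I. to_fract g ^ N * f i ^ Poly_Mapping.lookup \<alpha> i)"
      unfolding P_def hom by (intro prod.cong) (auto simp: hom)
    also have "\<dots> = to_fract g ^ (N * m) * monomial_value f \<alpha>"
      using fin that by (subst monomial_value_superset[of I]) (auto simp: A_def prod.distrib power_mult m_def)
    finally show ?thesis .
  qed
  note P = this
  have "to_fract g ^ (N * m) * fract_ev f q = (\<Sum>\<alpha>\<in>A. const_fract (c \<alpha>) * to_fract (P \<alpha>))"
    unfolding q_def coeff_hom.hom_sum[OF coeff_hom.coeff_hom_ev[OF coeff_hom_const_fract]] sum_distrib_left
    by (rule sum.cong) (simp_all add: coeff_hom.ev_single[OF coeff_hom_const_fract] P mult_ac)
  also have "\<dots> = to_fract (\<Sum>\<alpha>\<in>A. mconst (c \<alpha>) * P \<alpha>)"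
    by (simp add: const_fract_def coeff_hom.hom_sum[OF coeff_hom_to_fract])
  finally have "fract_ev f q = 0" using c(2) g0 by simp
  then show ?thesis
    using \<open>q \<noteq> 0\<close> \<open>vars_in I q\<close> unfolding alg_indep_family_def by blast
qed

section \<open>The Jacobian criterion\<close>

text \<open>The quotient rule on an arbitrarily chosen representation;
  \<open>fract_deriv_Fract\<close> shows that the choice does not matter.\<close>

definition fract_deriv :: "'n \<Rightarrow> ('n::linorder, 'a::idom) mpoly fract \<Rightarrow> ('n, 'a) mpoly fract" where
  "fract_deriv j x = (SOME y. \<exists>a b. b \<noteq> 0 \<and> x = Fract a b \<and>
     y = Fract (b * partial_deriv j a - a * partial_deriv j b) (b * b))"

lemma fract_deriv_Fract:
  fixes a b :: "('n::linorder, 'a::idom) mpoly"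
  assumes "b \<noteq> 0"
  shows "fract_deriv j (Fract a b) = Fract (b * partial_deriv j a - a * partial_deriv j b) (b * b)"
  unfolding fract_deriv_def
proof (rule some_equality)
  fix y assume "\<exists>a' b'. b' \<noteq> 0 \<and> Fract a b = Fract a' b' \<and>
     y = Fract (b' * partial_deriv j a' - a' * partial_deriv j b') (b' * b')"
  then obtain a' b' where *: "b' \<noteq> 0" "Fract a b = Fract a' b'"
    "y = Fract (b' * partial_deriv j a' - a' * partial_deriv j b') (b' * b')" by blast
  have eq: "a * b' = a' * b" using * assms by (simp add: eq_fract)
  let ?D = "partial_deriv j"
  \<comment> \<open>The cross-multiplied identity, differentiated and solved for one term.\<close>
  have "b' * ?D a = a' * ?D b + b * ?D a' - a * ?D b'"
    using arg_cong[OF eq, of ?D] by (simp add: partial_deriv_mult algebra_simps)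
  note D = this
  have "(b * ?D a - a * ?D b) * (b' * b') = b * b' * (b' * ?D a) - (a * b') * (b' * ?D b)"
    by (simp add: algebra_simps)
  also have "\<dots> = b * b' * (a' * ?D b + b * ?D a' - a * ?D b') - (a * b') * (b' * ?D b)"
    unfolding D ..
  also have "\<dots> = b * b' * (a' * ?D b + b * ?D a') - b * ?D b' * (a * b') - (a * b') * (b' * ?D b)"
    by (simp add: algebra_simps)
  also have "\<dots> = (b' * ?D a' - a' * ?D b') * (b * b)"
    unfolding eq by (simp add: algebra_simps)
  finally have "(b * ?D a - a * ?D b) * (b' * b') = (b' * ?D a' - a' * ?D b') * (b * b)" .
  then show "y = Fract (b * ?D a - a * ?D b) (b * b)"
    using * assms by (simp add: eq_fract)
qed (use assms in blast)

lemma partial_deriv_1 [simp]: "partial_deriv i 1 = 0"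
  by (metis mconst_1 partial_deriv_mconst)

lemma fract_deriv_to_fract [simp]: "fract_deriv j (to_fract p) = to_fract (partial_deriv j p)"
  using fract_deriv_Fract[of 1 j p] by (simp add: to_fract_def)

lemma fract_deriv_add: "fract_deriv j (x + y) = fract_deriv j x + fract_deriv j y"
  by (cases x; cases y)
    (simp add: fract_deriv_Fract partial_deriv_add partial_deriv_mult eq_fract algebra_simps)

lemma fract_deriv_mult: "fract_deriv j (x * y) = x * fract_deriv j y + y * fract_deriv j x"
  by (cases x; cases y)
    (simp add: fract_deriv_Fract partial_deriv_add partial_deriv_mult eq_fract algebra_simps)

lemma fract_deriv_const [simp]: "fract_deriv j (const_fract a) = 0"
  by (simp add: const_fract_def)

lemma fract_deriv_fract_ev:
  assumes "finite S" "vars_in S p"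
  shows "fract_deriv j (fract_ev f p) = (\<Sum>i\<in>S. fract_ev f (partial_deriv i p) * fract_deriv j (f i))"
  using derivation_eq[OF assms coeff_hom.coeff_hom_ev[OF coeff_hom_const_fract, of f], of "\<lambda>p. fract_deriv j (fract_ev f p)"]
  by (simp add: fract_ev_hom fract_deriv_add fract_deriv_mult)

lemma lookup_partial_deriv:
  "Poly_Mapping.lookup (partial_deriv i p) m =
    of_nat (Poly_Mapping.lookup m i + 1) * Poly_Mapping.lookup p (m + Poly_Mapping.single i 1)"
proof (induction p rule: mpoly_induct)
  case (single m' a)
  show ?case
  proof (cases "Poly_Mapping.lookup m' i = 0")
    case True
    then have "m' \<noteq> m + Poly_Mapping.single i 1" by (auto simp: lookup_add)
    then show ?thesis using True by (simp add: partial_deriv_single lookup_single)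
  next
    case False
    then have "m' - Poly_Mapping.single i 1 + Poly_Mapping.single i 1 = m'"
      by (intro poly_mapping_eqI) (auto simp: lookup_add lookup_minus lookup_single when_def)
    then have "m' - Poly_Mapping.single i 1 = m \<longleftrightarrow> m' = m + Poly_Mapping.single i 1"
      by (metis add_diff_cancel_right')
    then show ?thesis
      by (auto simp: partial_deriv_single lookup_single when_def lookup_add)
  qed
qed (simp add: partial_deriv_add lookup_add distrib_left)

text \<open>In characteristic zero the exponent brought down by differentiation cannot annihilate a
  coefficient.\<close>

lemma partial_deriv_eq_0_imp:
  fixes p :: "('i, 'a::{idom,ring_char_0}) mpoly"
  assumes "partial_deriv i p = 0"
  shows "vars_in (UNIV - {i}) p"
  unfolding vars_in_def
proof (intro ballI, rule ccontr)
  fix m assume m: "m \<in> Poly_Mapping.keys p" "\<not> Poly_Mapping.keys m \<subseteq> UNIV - {i}"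
  then have "Poly_Mapping.lookup m i \<noteq> 0" by (auto simp: in_keys_iff)
  then have "m - Poly_Mapping.single i 1 + Poly_Mapping.single i 1 = m"
    by (intro poly_mapping_eqI) (auto simp: lookup_add lookup_minus lookup_single when_def)
  then have "of_nat (Poly_Mapping.lookup (m - Poly_Mapping.single i 1) i + 1) * Poly_Mapping.lookup p m = 0"
    using lookup_partial_deriv[of i p "m - Poly_Mapping.single i 1"] assms by simp
  then show False using m(1) by (simp add: in_keys_iff del: of_nat_Suc of_nat_add)
qed

lemma vars_in_partial_deriv:
  assumes "vars_in S p" shows "vars_in S (partial_deriv i p)"
  unfolding partial_deriv_def
proof (rule vars_in_sum)
  fix m assume m: "m \<in> Poly_Mapping.keys p"
  have "Poly_Mapping.keys (m - Poly_Mapping.single i 1) \<subseteq> Poly_Mapping.keys m"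
    by (auto simp: in_keys_iff lookup_minus)
  then show "vars_in S (Poly_Mapping.single (m - Poly_Mapping.single i 1)
      (of_nat (Poly_Mapping.lookup m i) * Poly_Mapping.lookup p m))"
    using assms m by (auto simp: vars_in_def)
qed

definition expo_size :: "('i \<Rightarrow>\<^sub>0 nat) \<Rightarrow> nat" where
  "expo_size m = (\<Sum>i\<in>Poly_Mapping.keys m. Poly_Mapping.lookup m i)"

lemma expo_size_add_single: "expo_size (m + Poly_Mapping.single i 1) = expo_size m + 1"
proof -
  have *: "expo_size m' = (\<Sum>i\<in>A. Poly_Mapping.lookup m' i)"
    if "finite A" "Poly_Mapping.keys m' \<subseteq> A" for m' :: "'a \<Rightarrow>\<^sub>0 nat" and A
    unfolding expo_size_def using that by (intro sum.mono_neutral_left) (auto simp: in_keys_iff)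
  let ?A = "insert i (Poly_Mapping.keys m)"
  have "Poly_Mapping.keys (m + Poly_Mapping.single i 1) \<subseteq> ?A"
    using keys_add[of m "Poly_Mapping.single i 1"] by auto
  then have "expo_size (m + Poly_Mapping.single i 1) = (\<Sum>k\<in>?A. Poly_Mapping.lookup (m + Poly_Mapping.single i 1) k)"
    by (intro *) auto
  also have "\<dots> = (\<Sum>k\<in>?A. Poly_Mapping.lookup m k) + (\<Sum>k\<in>?A. if i = k then 1 else 0)"
    by (simp add: lookup_add lookup_single when_def sum.distrib del: sum.insert_remove sum.insert)
  also have "(\<Sum>k\<in>?A. Poly_Mapping.lookup m k) = expo_size m"
    by (intro *[symmetric]) auto
  finally show ?thesis by (simp del: sum.insert_remove sum.insert)
qed

definition degree_le :: "nat \<Rightarrow> ('i, 'a::zero) mpoly \<Rightarrow> bool" where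
  "degree_le d p \<longleftrightarrow> (\<forall>m\<in>Poly_Mapping.keys p. expo_size m \<le> d)"

lemma degree_le_exists: "\<exists>d. degree_le d p"
  unfolding degree_le_def
  by (metis Max_ge finite_imageI finite_keys imageI)

lemma degree_le_partial_deriv:
  fixes p :: "('i, 'a::comm_semiring_1) mpoly"
  assumes "degree_le d p"
  shows "partial_deriv i p = 0 \<or> d > 0 \<and> degree_le (d - 1) (partial_deriv i p)"
proof -
  have "expo_size m + 1 \<le> d" if "m \<in> Poly_Mapping.keys (partial_deriv i p)" for m
  proof -
    have "m + Poly_Mapping.single i 1 \<in> Poly_Mapping.keys p"
      using that by (auto simp: in_keys_iff lookup_partial_deriv)
    then show ?thesis using assms unfolding degree_le_def by (metis expo_size_add_single)
  qed
  then show ?thesis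
    unfolding degree_le_def by (cases "d = 0") (fastforce simp flip: keys_eq_empty)+
qed

lemma fract_deriv_0 [simp]: "fract_deriv j 0 = 0"
  using fract_deriv_to_fract[of j 0] by simp

lemma fract_deriv_1 [simp]: "fract_deriv j 1 = 0"
  using fract_deriv_to_fract[of j 1] by simp

text \<open>Differentiating a relation \<open>q\<close> gives a linear relation between the
  gradients, so every partial derivative of \<open>q\<close> is again a relation. These have smaller
  degree and vanish by induction; hence \<open>q\<close> is constant, and a constant relation is
  zero.\<close>

lemma alg_indep_family_of_gradients:
  fixes f :: "'i \<Rightarrow> ('n::linorder, 'a::{idom,ring_char_0}) mpoly fract"
  assumes fin: "finite I"
    and grad: "\<And>c. (\<And>j. (\<Sum>i\<in>I. c i * fract_deriv j (f i)) = 0) \<Longrightarrow> \<forall>i\<in>I. c i = 0"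
  shows "alg_indep_family I f"
proof -
  have "q = 0" if "degree_le d q" "vars_in I q" "fract_ev f q = 0" for d q
    using that
  proof (induction d arbitrary: q rule: less_induct)
    case (less d)
    have "(\<Sum>i\<in>I. fract_ev f (partial_deriv i q) * fract_deriv j (f i)) = 0" for j
      using fract_deriv_fract_ev[OF fin less.prems(2), of j f] less.prems(3) by simp
    then have ev0: "\<forall>i\<in>I. fract_ev f (partial_deriv i q) = 0"
      by (intro grad[of "\<lambda>i. fract_ev f (partial_deriv i q)"])
    have "partial_deriv i q = 0" if "i \<in> I" for i
    proof (rule ccontr)
      assume nz: "partial_deriv i q \<noteq> 0"
      then have "d - 1 < d" "degree_le (d - 1) (partial_deriv i q)"
        using degree_le_partial_deriv[OF less.prems(1), of i] by auto
      then have "partial_deriv i q = 0"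
        by (rule less.IH) (use ev0 that less.prems(2) vars_in_partial_deriv in auto)
      with nz show False ..
    qed
    then have "vars_in (UNIV - {k}) q" for k
      using partial_deriv_eq_0_imp[of k q] vars_in_mono[OF less.prems(2), of "UNIV - {k}"] by blast
    then have "vars_in {} q" by (rule vars_inI)
    then obtain a where "q = mconst a" using vars_in_empty_imp by blast
    then show ?case using less.prems(3) by (simp add: fract_ev_hom)
  qed
  then show ?thesis
    unfolding alg_indep_family_def using degree_le_exists by blast
qed

section \<open>Gradients, the row space of the Jacobian matrix and transcendence degree\<close>

definition gradient :: "('n::{finite,linorder}, 'a::idom) mpoly fract \<Rightarrow> (('n, 'a) mpoly fract, 'n) vec" where
  "gradient x = (\<chi> j. fract_deriv j x)"

lemma gradient_nth [simp]: "gradient x $ j = fract_deriv j x"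
  by (simp add: gradient_def)

lemma gradient_pvar: "gradient (to_fract (pvar k)) = axis k 1"
  by (simp add: vec_eq_iff partial_deriv_pvar axis_def)

lemma independent_family_coeff_0:
  fixes v :: "'i \<Rightarrow> ('f::field, 'n::finite) vec"
  assumes "finite I" "inj_on v I" "vec.independent (v ` I)"
    and "\<And>j. (\<Sum>i\<in>I. c i * v i $ j) = 0"
  shows "\<forall>i\<in>I. c i = 0"
proof -
  have "(\<Sum>i\<in>I. c i *s v i) = 0" using assms(4) by (simp add: vec_eq_iff)
  then have "(\<Sum>x\<in>v ` I. c (the_inv_into I v x) *s x) = 0"
    using assms(2) by (simp add: sum.reindex the_inv_into_f_f)
  then have "\<forall>x\<in>v ` I. c (the_inv_into I v x) = 0"
    using vec.independentD[OF assms(3) finite_imageI[OF assms(1)] subset_refl,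
        of "\<lambda>x. c (the_inv_into I v x)"] by blast
  then show ?thesis using assms(2) by (simp add: the_inv_into_f_f)
qed

text \<open>Extend \<open>S\<close> by coordinates to a maximal independent set \<open>B\<close>.
  Each coordinate then satisfies a relation over \<open>B\<close>, and differentiating it puts its
  gradient, a unit vector, into the span of the gradients of \<open>B\<close>. So at most n
  gradients span an n-dimensional space, which makes them distinct and independent.\<close>

lemma alg_indep_imp_gradients_independent:
  fixes S :: "('n::{finite,linorder}, 'a::field_char_0) mpoly fract set"
  assumes fin: "finite S" and indep: "alg_indep_family S (\<lambda>x. x)"
  shows "inj_on gradient S" "vec.independent (gradient ` S)"
proof -
  define V where "V = range (\<lambda>j::'n. to_fract (pvar j :: ('n, 'a) mpoly))"
  \<comment> \<open>Adding only coordinates keeps the candidates finite in number, so a maximal one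
    exists.\<close>
  define F where "F = {B. S \<subseteq> B \<and> B \<subseteq> S \<union> V \<and> alg_indep_family B (\<lambda>x. x)}"
  have "finite F" using fin by (intro finite_subset[of F "Pow (S \<union> V)"]) (auto simp: F_def V_def)
  moreover have "S \<in> F" using indep by (auto simp: F_def)
  ultimately obtain B where B: "B \<in> F" and max: "\<And>C. C \<in> F \<Longrightarrow> B \<subseteq> C \<Longrightarrow> B = C"
    using finite_has_maximal[of F] by blast
  have finB: "finite B" using B fin by (auto simp: F_def V_def intro: finite_subset)
  have indB: "alg_indep_family B (\<lambda>x. x)" using B by (simp add: F_def)
  have "gradient x \<in> vec.span (gradient ` B)" if x: "x \<in> V" for x
  proof (cases "x \<in> B")
    case False
    define rel where "rel q \<longleftrightarrow> q \<noteq> 0 \<and> vars_in (insert x B) q \<and> fract_ev (\<lambda>x. x) q = 0" for q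
    have "\<not> alg_indep_family (insert x B) (\<lambda>x. x)"
      using max[of "insert x B"] B x False by (auto simp: F_def)
    then have "\<exists>q. rel q" unfolding alg_indep_family_def rel_def by blast
    then have ex: "\<exists>d q. rel q \<and> degree_le d q" using degree_le_exists by blast
    \<comment> \<open>Least degree ensures that a nonzero partial derivative of the relation is not
      itself a relation.\<close>
    define d where "d = (LEAST d. \<exists>q. rel q \<and> degree_le d q)"
    obtain q where q: "rel q" "degree_le d q" using LeastI_ex[OF ex] by (auto simp: d_def)
    have min: "d \<le> e" if "rel q" "degree_le e q" for e q
      unfolding d_def using that by (intro Least_le) blast
    define e where "e b = fract_ev (\<lambda>x. x) (partial_deriv b q)" for b
    \<comment> \<open>Otherwise the derivative in \<open>x\<close> is either a relation of smaller
      degree or zero; in the latter case \<open>q\<close> is free of \<open>x\<close> and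
      contradicts the independence of \<open>B\<close>.\<close>
    have "e x \<noteq> 0"
    proof
      assume ex: "e x = 0"
      have "partial_deriv x q = 0"
      proof (rule ccontr)
        assume nz: "partial_deriv x q \<noteq> 0"
        then have "rel (partial_deriv x q)"
          using q(1) ex vars_in_partial_deriv by (auto simp: rel_def e_def)
        moreover have "d > 0" "degree_le (d - 1) (partial_deriv x q)"
          using nz degree_le_partial_deriv[OF q(2), of x] by auto
        ultimately show False using min[of "partial_deriv x q" "d - 1"] by linarith
      qed
      then have "vars_in (UNIV - {x}) q" by (rule partial_deriv_eq_0_imp)
      then have "vars_in (insert x B \<inter> (UNIV - {x})) q"
        using q(1) by (intro vars_in_Int) (auto simp: rel_def)
      then have "vars_in B q" by (rule vars_in_mono) auto
      then show False using indB q(1) by (auto simp: alg_indep_family_def rel_def)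
    qed
    have "(\<Sum>b\<in>insert x B. e b * fract_deriv j b) = 0" for j
      using fract_deriv_fract_ev[of "insert x B" q j "\<lambda>x. x"] finB q(1)
      by (simp add: rel_def e_def)
    then have "e x * fract_deriv j x = - (\<Sum>b\<in>B. e b * fract_deriv j b)" for j
      using False finB by (simp add: eq_neg_iff_add_eq_0)
    then have "fract_deriv j x = (\<Sum>b\<in>B. (- e b / e x) * fract_deriv j b)" for j
      using \<open>e x \<noteq> 0\<close> by (simp add: field_simps sum_negf flip: sum_divide_distrib)
    then have "gradient x = (\<Sum>b\<in>B. (- e b / e x) *s gradient b)"
      by (simp add: vec_eq_iff)
    also have "\<dots> \<in> vec.span (gradient ` B)"
      by (intro vec.span_sum vec.span_scale vec.span_base) auto
    finally show ?thesis .
  qed (auto intro: vec.span_base)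
  then have "axis k 1 \<in> vec.span (gradient ` B)" for k
    unfolding V_def by (metis gradient_pvar rangeI)
  then have span: "vec.span (gradient ` B) = UNIV"
    using vec.span_mono[of cart_basis "vec.span (gradient ` B)"] span_cart_basis
    by (auto simp: cart_basis_def vec.span_span)
  \<comment> \<open>Over a common denominator the members of \<open>B\<close> are quotients of
    polynomials in n variables, so the counting bound applies.\<close>
  have "card B \<le> CARD('n)"
  proof (rule ccontr)
    assume "\<not> card B \<le> CARD('n)"
    obtain num den :: "('n, 'a) mpoly fract \<Rightarrow> ('n, 'a) mpoly" where nd: "den x \<noteq> 0" "x = Fract (num x) (den x)" for x
      by (metis Fract_cases)
    define g where "g = (\<Prod>b\<in>B. den b)"
    define nm where "nm b = num b * (\<Prod>c\<in>B - {b}. den c)" for b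
    have "b = to_fract (nm b) / to_fract g" if "b \<in> B" for b
    proof -
      have "(\<Prod>c\<in>B - {b}. den c) \<noteq> 0" using nd finB by simp
      moreover have "g = den b * (\<Prod>c\<in>B - {b}. den c)"
        using finB that by (simp add: g_def prod.remove)
      ultimately have "Fract (nm b) g = Fract (num b) (den b)"
        using nd(1)[of b] by (simp add: nm_def eq_fract)
      then have "Fract (nm b) g = b" using nd(2)[of b] by simp
      then show ?thesis by (simp add: Fract_conv_to_fract)
    qed
    moreover have "g \<noteq> 0" using nd finB by (simp add: g_def)
    ultimately have "\<not> alg_indep_family B (\<lambda>x. x)"
      using \<open>\<not> card B \<le> CARD('n)\<close> finB by (intro alg_dependent_of_card[of _ UNIV g nm]) auto
    then show False using indB by blast
  qed
  moreover have "CARD('n) \<le> card (gradient ` B)"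
    using vec.dim_le_card[of UNIV "gradient ` B"] span finB by (simp add: vec.dim_UNIV card_cart_basis)
  ultimately have card: "card (gradient ` B) = card B" "card (gradient ` B) = CARD('n)"
    using card_image_le[OF finB, of gradient] by auto
  have "vec.independent (gradient ` B)"
    using vec.card_le_dim_spanning[of "gradient ` B" UNIV] span finB card by (simp add: vec.dim_UNIV card_cart_basis)
  moreover have "inj_on gradient B" using finB card(1) by (rule eq_card_imp_inj_on)
  moreover have "S \<subseteq> B" using B by (simp add: F_def)
  ultimately show "inj_on gradient S" "vec.independent (gradient ` S)"
    using vec.independent_mono[of "gradient ` B" "gradient ` S"] by (auto intro: inj_on_subset)
qed

lemma row_jacobian: "row i (jacobian h) = gradient (to_fract (h $ i))"
  by (simp add: row_def jacobian_def vec_eq_iff)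

lemma independent_rows_of_rank:
  fixes A :: "(('f::field, 'n::finite) vec, 'm::finite) vec"
  obtains I where "card I = rank A" "inj_on (\<lambda>i. row i A) I" "vec.independent ((\<lambda>i. row i A) ` I)"
proof -
  obtain B where B: "B \<subseteq> rows A" "vec.independent B" "card B = vec.dim (rows A)"
    using vec.basis_exists[of "rows A"] by metis
  have "rows A = range (\<lambda>i. row i A)" by (auto simp: rows_def)
  then obtain I where I: "inj_on (\<lambda>i. row i A) I" "B = (\<lambda>i. row i A) ` I"
    using B(1) subset_image_inj[of B "\<lambda>i. row i A" UNIV] by auto
  then show ?thesis using that[of I] B by (simp add: card_image row_rank_def_gen)
qed

text \<open>The elements whose gradient lies in the row space form a field, by the sum, product and
  quotient rules, and this field contains the generators.\<close>

lemma gen_subfield_gradient: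
  fixes h :: "(('n::{finite,linorder}, 'a::field) mpoly, 'n) vec"
  assumes "x \<in> gen_subfield h"
  shows "gradient x \<in> vec.span (rows (jacobian h))"
  using assms unfolding gen_subfield_def
proof (induction rule: generate_field.induct)
  case one
  have "gradient 1 = (0 :: (('n, 'a) mpoly fract, 'n) vec)"
    using fract_deriv_to_fract[of _ "1 :: ('n, 'a) mpoly"] by (simp add: vec_eq_iff)
  then show ?case by (simp add: ring_of_type_algebra_def vec.span_zero)
next
  case (incl x)
  then consider a where "x = const_fract a" | i where "x = to_fract (h $ i)"
    by (auto simp: const_field_def const_fract_def)
  then show ?case
  proof cases
    case 1
    then have "gradient x = 0" by (simp add: vec_eq_iff)
    then show ?thesis by (simp add: vec.span_zero)
  next
    case 2
    then show ?thesis by (auto intro!: vec.span_base simp: rows_def simp flip: row_jacobian)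
  qed
next
  case (a_inv x)
  interpret cring "ring_of_type_algebra :: ('n, 'a) mpoly fract ring" by blast
  have "\<ominus>\<^bsub>ring_of_type_algebra\<^esub> x = - x"
    by (rule minus_equality) (simp_all add: ring_of_type_algebra_def)
  moreover have "gradient (- x) = - gradient x"
    using fract_deriv_add[of _ x "-x"] by (simp add: vec_eq_iff eq_neg_iff_add_eq_0 add.commute)
  ultimately show ?case using a_inv by (simp add: vec.span_neg)
next
  case (m_inv x)
  interpret cring "ring_of_type_algebra :: ('n, 'a) mpoly fract ring" by blast
  have x: "x \<noteq> 0" using m_inv by (simp add: ring_of_type_algebra_def)
  have "inv\<^bsub>ring_of_type_algebra\<^esub> x = inverse x"
    by (rule comm_inv_char) (use x in \<open>simp_all add: ring_of_type_algebra_def\<close>)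
  moreover have "gradient (inverse x) = (- inverse x * inverse x) *s gradient x"
  proof -
    have "x * fract_deriv j (inverse x) + inverse x * fract_deriv j x = 0" for j
      using fract_deriv_mult[of j x "inverse x"] x by simp
    then have "inverse x * (x * fract_deriv j (inverse x) + inverse x * fract_deriv j x) = 0" for j
      by simp
    then have "fract_deriv j (inverse x) + inverse x * inverse x * fract_deriv j x = 0" for j
      using x by (simp add: distrib_left mult.assoc[symmetric])
    then show ?thesis by (simp add: vec_eq_iff eq_neg_iff_add_eq_0)
  qed
  ultimately show ?case using m_inv by (simp add: vec.span_scale vec.span_neg)
next
  case (eng_add x y)
  have "gradient (x + y) = gradient x + gradient y" by (simp add: vec_eq_iff fract_deriv_add)
  then show ?case using eng_add by (simp add: ring_of_type_algebra_def vec.span_add)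
next
  case (eng_mult x y)
  have "gradient (x * y) = x *s gradient y + y *s gradient x" by (simp add: vec_eq_iff fract_deriv_mult)
  then show ?case using eng_mult by (simp add: ring_of_type_algebra_def vec.span_add vec.span_scale)
qed

lemma jacobian_rows_alg_indep:
  fixes h :: "(('n::{finite,linorder}, 'a::field_char_0) mpoly, 'n) vec"
  assumes "inj_on (\<lambda>i. row i (jacobian h)) I" "vec.independent ((\<lambda>i. row i (jacobian h)) ` I)"
  shows "alg_indep_family I (\<lambda>i. to_fract (h $ i))"
proof (rule alg_indep_family_of_gradients)
  show "\<forall>i\<in>I. c i = 0" if "\<And>j. (\<Sum>i\<in>I. c i * fract_deriv j (to_fract (h $ i))) = 0" for c
    using independent_family_coeff_0[OF _ assms, of c] that by (simp add: row_jacobian)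
qed simp

text \<open>Independent elements of the field have independent gradients inside the row space;
  conversely, independent rows are gradients of components that are therefore independent.\<close>

theorem tr_deg_gen_subfield:
  fixes h :: "(('n::{finite,linorder}, 'a::field_char_0) mpoly, 'n) vec"
  shows "tr_deg const_field (gen_subfield h) = enat (rank (jacobian h))"
proof (rule antisym)
  show "tr_deg const_field (gen_subfield h) \<le> enat (rank (jacobian h))"
    unfolding tr_deg_def
  proof (rule Sup_least)
    fix k assume "k \<in> {enat (card S) |S. finite S \<and> S \<subseteq> gen_subfield h \<and> alg_independent const_field S}"
    then obtain S where S: "k = enat (card S)" "finite S" "S \<subseteq> gen_subfield h" "alg_indep_family S (\<lambda>x. x)"
      by (auto simp: alg_independent_const_field)
    have "gradient ` S \<subseteq> vec.span (rows (jacobian h))" using S gen_subfield_gradient by blast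
    then have "card (gradient ` S) \<le> rank (jacobian h)"
      using vec.independent_card_le_dim[of "gradient ` S"] alg_indep_imp_gradients_independent[OF S(2,4)]
      unfolding row_rank_def_gen by (metis vec.dim_span)
    then show "k \<le> enat (rank (jacobian h))"
      using alg_indep_imp_gradients_independent(1)[OF S(2,4)] by (simp add: S(1) card_image)
  qed
  obtain I where I: "card I = rank (jacobian h)" "inj_on (\<lambda>i. row i (jacobian h)) I"
    "vec.independent ((\<lambda>i. row i (jacobian h)) ` I)" by (rule independent_rows_of_rank)
  define f where "f = (\<lambda>i. to_fract (h $ i))"
  have grad: "(\<lambda>i. row i (jacobian h)) = gradient \<circ> f" by (simp add: fun_eq_iff f_def row_jacobian)
  have inj: "inj_on f I" "inj_on gradient (f ` I)" using I(2) unfolding grad by (auto dest: inj_on_imageI2 inj_on_imageI)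
  have I3: "vec.independent (gradient ` (f ` I))" using I(3) unfolding grad image_comp .
  have "alg_indep_family (f ` I) (\<lambda>x. x)"
  proof (rule alg_indep_family_of_gradients)
    show "\<forall>i\<in>f ` I. c i = 0" if "\<And>j. (\<Sum>i\<in>f ` I. c i * fract_deriv j i) = 0" for c
      using independent_family_coeff_0[OF _ inj(2) I3, of c] that by simp
  qed simp
  moreover have "f ` I \<subseteq> gen_subfield h"
    by (auto simp: gen_subfield_def f_def intro!: generate_field.incl)
  ultimately show "enat (rank (jacobian h)) \<le> tr_deg const_field (gen_subfield h)"
    unfolding tr_deg_def using I(1) inj(1)
    by (intro Sup_upper) (auto simp: alg_independent_const_field card_image intro!: exI[of _ "f ` I"])
qed

section \<open>Prime chains and algebraic independence\<close>

lemma gen_subalgebra_eq: "gen_subalgebra h = range (ev mconst (($) h))"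
proof
  show "gen_subalgebra h \<subseteq> range (ev mconst (($) h))"
  proof
    fix x assume "x \<in> gen_subalgebra h"
    then show "x \<in> range (ev mconst (($) h))"
      unfolding gen_subalgebra_def
    proof (induction rule: generate_ring.induct)
      case one
      show ?case
        by (rule range_eqI[of _ _ 1]) (simp add: ring_of_type_algebra_def coeff_hom.ev_1[OF coeff_hom_mconst])
    next
      case (incl x)
      then consider a where "x = mconst a" | i where "x = h $ i" by blast
      then show ?case
        by cases (metis coeff_hom.ev_mconst[OF coeff_hom_mconst] rangeI,
          metis coeff_hom.ev_pvar[OF coeff_hom_mconst] rangeI)
    next
      case (a_inv x)
      interpret cring "ring_of_type_algebra :: ('a, 'b) mpoly ring" by blast
      have "\<ominus>\<^bsub>ring_of_type_algebra\<^esub> x = - x"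
        by (rule minus_equality) (simp_all add: ring_of_type_algebra_def)
      then show ?case
        using a_inv by (metis (no_types, lifting) coeff_hom.hom_uminus[OF coeff_hom.coeff_hom_ev[OF coeff_hom_mconst]] imageE rangeI)
    next
      case (eng_add x y)
      then show ?case
        by (auto simp: ring_of_type_algebra_def simp flip: coeff_hom.ev_add[OF coeff_hom_mconst])
    next
      case (eng_mult x y)
      then show ?case
        by (auto simp: ring_of_type_algebra_def simp flip: coeff_hom.ev_mult[OF coeff_hom_mconst])
    qed
  qed
  show "range (ev mconst (($) h)) \<subseteq> gen_subalgebra h"
  proof clarify
    fix q :: "('a, 'b) mpoly"
    show "ev mconst (($) h) q \<in> gen_subalgebra h"
      unfolding gen_subalgebra_def
      using generate_ring.eng_add[where R = "ring_of_type_algebra :: ('a, 'b) mpoly ring"]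
        generate_ring.eng_mult[where R = "ring_of_type_algebra :: ('a, 'b) mpoly ring"]
      by (intro ev_closed[OF coeff_hom_mconst vars_in_UNIV])
        (auto intro!: generate_ring.incl simp: ring_of_type_algebra_def)
  qed
qed

lemma cring_gen_subalgebra: "cring (ring_of_type_algebra\<lparr>carrier := gen_subalgebra h\<rparr>)"
proof -
  interpret cring "ring_of_type_algebra :: ('a, 'b) mpoly ring" by blast
  have "subring (gen_subalgebra h) ring_of_type_algebra"
    unfolding gen_subalgebra_def by (rule generate_ring_is_subring) (simp add: ring_of_type_algebra_def)
  then show ?thesis
    using subcringI' subcring_iff[of "gen_subalgebra h"] by (simp add: ring_of_type_algebra_def)
qed

lemma primeideal_gen_subalgebraD:
  fixes h :: "(('n::{finite,linorder}, 'a::field) mpoly, 'n) vec"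
  assumes "primeideal P (ring_of_type_algebra\<lparr>carrier := gen_subalgebra h\<rparr>)"
  shows "P \<subseteq> gen_subalgebra h" "0 \<in> P" "1 \<notin> P"
    "\<And>a b. a \<in> P \<Longrightarrow> b \<in> P \<Longrightarrow> a + b \<in> P"
    "\<And>a b. a \<in> gen_subalgebra h \<Longrightarrow> b \<in> P \<Longrightarrow> a * b \<in> P"
    "\<And>a b. a \<in> gen_subalgebra h \<Longrightarrow> b \<in> gen_subalgebra h \<Longrightarrow> a * b \<in> P \<Longrightarrow> a \<in> P \<or> b \<in> P"
proof -
  interpret primeideal P "ring_of_type_algebra\<lparr>carrier := gen_subalgebra h\<rparr>" by fact
  show "P \<subseteq> gen_subalgebra h" using a_subset by simp
  show "0 \<in> P" using additive_subgroup.zero_closed[OF additive_subgroup_axioms] by (simp add: ring_of_type_algebra_def)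
  show "1 \<notin> P" using one_imp_carrier I_notcarr by (auto simp: ring_of_type_algebra_def)
  show "a + b \<in> P" if "a \<in> P" "b \<in> P" for a b
    using additive_subgroup.a_closed[OF additive_subgroup_axioms that] by (simp add: ring_of_type_algebra_def)
  show "a * b \<in> P" if "a \<in> gen_subalgebra h" "b \<in> P" for a b
    using I_l_closed[of b a] that by (simp add: ring_of_type_algebra_def)
  show "a \<in> P \<or> b \<in> P" if "a \<in> gen_subalgebra h" "b \<in> gen_subalgebra h" "a * b \<in> P" for a b
    using I_prime[of a b] that by (simp add: ring_of_type_algebra_def)
qed

text \<open>Source of all primes in the chain built below: kernels of homomorphisms into a domain,
  cut down to the subalgebra.\<close>

lemma primeideal_gen_subalgebraI:
  fixes h :: "(('n::{finite,linorder}, 'a::field) mpoly, 'n) vec" and f :: "('n, 'a) mpoly \<Rightarrow> 'b::idom"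
  assumes "coeff_hom f"
  shows "primeideal {x \<in> gen_subalgebra h. f x = 0} (ring_of_type_algebra\<lparr>carrier := gen_subalgebra h\<rparr>)"
proof (rule primeidealI2)
  interpret coeff_hom f by fact
  let ?R = "ring_of_type_algebra\<lparr>carrier := gen_subalgebra h\<rparr>"
  interpret R: cring ?R by (rule cring_gen_subalgebra)
  show "cring ?R" by (rule cring_gen_subalgebra)
  have closed: "x + y \<in> gen_subalgebra h" "x * y \<in> gen_subalgebra h" if "x \<in> gen_subalgebra h" "y \<in> gen_subalgebra h" for x y
    using R.a_closed[of x y] R.m_closed[of x y] that by (simp_all add: ring_of_type_algebra_def)
  have "0 \<in> gen_subalgebra h" "1 \<in> gen_subalgebra h"
    using R.zero_closed R.one_closed by (simp_all add: ring_of_type_algebra_def)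
  have minus: "- x \<in> gen_subalgebra h" if "x \<in> gen_subalgebra h" for x
  proof -
    have "mconst (-1) \<in> gen_subalgebra h"
      unfolding gen_subalgebra_def by (intro generate_ring.incl) auto
    then have "mconst (-1) * x \<in> gen_subalgebra h" using closed that by blast
    then show ?thesis by (simp add: coeff_hom.hom_uminus[OF coeff_hom_mconst])
  qed
  have inv: "\<ominus>\<^bsub>?R\<^esub> x = - x" if "x \<in> gen_subalgebra h" for x
    by (rule R.minus_equality) (use that minus[OF that] in \<open>simp_all add: ring_of_type_algebra_def\<close>)
  show "additive_subgroup {x \<in> gen_subalgebra h. f x = 0} ?R"
  proof (intro additive_subgroupI R.add.subgroupI)
    show "\<ominus>\<^bsub>?R\<^esub> a \<in> {x \<in> gen_subalgebra h. f x = 0}"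
      if "a \<in> {x \<in> gen_subalgebra h. f x = 0}" for a
    proof -
      have e: "\<ominus>\<^bsub>?R\<^esub> a = - a" using that inv by blast
      show ?thesis unfolding e using that by (simp add: minus hom_uminus)
    qed
  qed (use closed \<open>0 \<in> gen_subalgebra h\<close> in \<open>auto simp: ring_of_type_algebra_def hom_add\<close>)
  show "carrier ?R \<noteq> {x \<in> gen_subalgebra h. f x = 0}"
  proof -
    have "1 \<in> carrier ?R" "1 \<notin> {x \<in> gen_subalgebra h. f x = 0}"
      using \<open>1 \<in> gen_subalgebra h\<close> by simp_all
    then show ?thesis by blast
  qed
qed (use coeff_hom.hom_mult[OF assms] cring.cring_simprules(5)[OF cring_gen_subalgebra[of h]]
  in \<open>auto simp: ring_of_type_algebra_def\<close>)

section \<open>From chains of primes to independent elements\<close>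

lemma split_variable:
  fixes q :: "('i, 'a::comm_ring_1) mpoly"
  assumes "vars_in (insert i T) q"
  shows "\<exists>q0 r. q = q0 + pvar i * r \<and> vars_in T q0 \<and> vars_in (insert i T) r"
  using assms
proof (induction q rule: vars_in_induct)
  case (const c)
  then show ?case by (intro exI[of _ "mconst c"] exI[of _ 0]) auto
next
  case (var j)
  then show ?case
  proof (cases "j = i")
    case True
    then show ?thesis by (intro exI[of _ 0] exI[of _ 1]) auto
  next
    case False
    then show ?thesis using var by (intro exI[of _ "pvar j"] exI[of _ 0]) auto
  qed
next
  case (add p q)
  then obtain p0 r q0 s where "p = p0 + pvar i * r" "vars_in T p0" "vars_in (insert i T) r"
    "q = q0 + pvar i * s" "vars_in T q0" "vars_in (insert i T) s" by blast
  then show ?case by (intro exI[of _ "p0 + q0"] exI[of _ "r + s"]) (auto simp: algebra_simps)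
next
  case (mult p q)
  then obtain p0 r q0 s where *: "p = p0 + pvar i * r" "vars_in T p0" "vars_in (insert i T) r"
    "q = q0 + pvar i * s" "vars_in T q0" "vars_in (insert i T) s" by blast
  then have "vars_in (insert i T) p0" "vars_in (insert i T) q0" by (auto intro: vars_in_mono)
  then show ?case using * by (intro exI[of _ "p0 * q0"] exI[of _ "p0 * s + r * q0 + pvar i * r * s"])
    (auto simp: algebra_simps)
qed

lemma alg_indep_family_image:
  assumes "inj_on f I" "alg_indep_family I f"
  shows "alg_indep_family (f ` I) (\<lambda>x. x)"
  unfolding alg_indep_family_def
proof (intro allI impI)
  fix q assume q: "vars_in (f ` I) q" "fract_ev (\<lambda>x. x) q = 0"
  define g where "g = the_inv_into I f"
  define r where "r = ev mconst (\<lambda>x. pvar (g x)) q"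
  have g: "g x \<in> I" "f (g x) = x" if "x \<in> f ` I" for x
    using that assms(1) by (auto simp: g_def the_inv_into_f_f)
  have "vars_in I r"
    unfolding r_def by (rule vars_in_ev[OF coeff_hom_mconst q(1)]) (auto simp: g)
  moreover have "fract_ev f r = fract_ev (\<lambda>x. x) q"
    unfolding r_def hom_ev[OF coeff_hom_mconst coeff_hom.coeff_hom_ev[OF coeff_hom_const_fract]]
    by (simp add: fract_ev_hom) (rule ev_cong[OF coeff_hom_const_fract q(1)], simp add: g)
  ultimately have "r = 0" using assms(2) q(2) by (auto simp: alg_indep_family_def)
  have "q = ev mconst (\<lambda>i. pvar (f i)) r"
    unfolding r_def hom_ev[OF coeff_hom_mconst coeff_hom.coeff_hom_ev[OF coeff_hom_mconst]]
    using ev_cong[OF coeff_hom_mconst q(1), of "\<lambda>x. pvar (f (g x))" pvar] g(2)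
    by (simp add: coeff_hom.ev_mconst[OF coeff_hom_mconst] coeff_hom.ev_pvar[OF coeff_hom_mconst])
  then show "q = 0" using \<open>r = 0\<close> by (simp add: coeff_hom.ev_0[OF coeff_hom_mconst])
qed

lemma gen_subalgebra_to_fract:
  assumes "x \<in> gen_subalgebra h"
  shows "to_fract x \<in> gen_subfield h"
proof -
  obtain q where x: "x = ev mconst (($) h) q" using assms by (auto simp: gen_subalgebra_eq)
  have "to_fract x = fract_ev (\<lambda>i. to_fract (h $ i)) q"
    unfolding x hom_ev[OF coeff_hom_mconst coeff_hom_to_fract] by (simp add: const_fract_def[abs_def])
  also have "\<dots> \<in> gen_subfield h"
    unfolding gen_subfield_def
    using generate_field.eng_add[where R = "ring_of_type_algebra :: ('a, 'b) mpoly fract ring"]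
      generate_field.eng_mult[where R = "ring_of_type_algebra :: ('a, 'b) mpoly fract ring"]
    by (intro ev_closed[OF coeff_hom_const_fract vars_in_UNIV])
      (auto intro!: generate_field.incl simp: ring_of_type_algebra_def const_field_def const_fract_def)
  finally show ?thesis .
qed

text \<open>
  Setting \<open>x\<^sub>i = 0\<close> modulo \<open>P (Suc i)\<close> and cancelling \<open>x\<^sub>i\<close> modulo \<open>P i\<close> moves a relation between
  \<open>x\<^sub>i, x\<^bsub>i+1\<^esub>, \<dots>\<close> lying in \<open>P i\<close> to one between \<open>x\<^bsub>i+1\<^esub>, \<dots>\<close> lying in \<open>P (Suc i)\<close>.
\<close>

lemma prime_chain_alg_indep:
  fixes h :: "(('n::{finite,linorder}, 'a::field) mpoly, 'n) vec"
  assumes prime: "\<And>i. i \<le> k \<Longrightarrow> primeideal (P i) (ring_of_type_algebra\<lparr>carrier := gen_subalgebra h\<rparr>)"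
    and sub: "\<And>i. i < k \<Longrightarrow> P i \<subseteq> P (Suc i)"
    and x: "\<And>i. i < k \<Longrightarrow> x i \<in> P (Suc i) - P i"
  shows "alg_indep_family {..<k} (\<lambda>i. to_fract (x i))"
proof -
  have xA: "x i \<in> gen_subalgebra h" if "i < k" for i
    using x[OF that] primeideal_gen_subalgebraD(1)[OF prime[of "Suc i"]] that by auto
  interpret R: cring "ring_of_type_algebra\<lparr>carrier := gen_subalgebra h\<rparr>" by (rule cring_gen_subalgebra)
  have closed: "x + y \<in> gen_subalgebra h" "x * y \<in> gen_subalgebra h" if "x \<in> gen_subalgebra h" "y \<in> gen_subalgebra h" for x y
    using R.a_closed[of x y] R.m_closed[of x y] that by (simp_all add: ring_of_type_algebra_def)
  have constA: "mconst a \<in> gen_subalgebra h" for a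
    unfolding gen_subalgebra_def by (intro generate_ring.incl) auto
  have evA: "ev mconst x q \<in> gen_subalgebra h" if "vars_in {i..<k} q" for q i
    by (rule ev_closed[OF coeff_hom_mconst that]) (auto intro: xA closed constA)
  have "q = 0" if "i \<le> k" "vars_in {i..<k} q" "ev mconst x q \<in> P i" for q i
    using that
  \<comment> \<open>The induction runs downwards from \<open>k\<close>, where no variables are left
    and a nonzero constant in a prime ideal would make 1 a member.\<close>
  proof (induction i arbitrary: q rule: inc_induct)
    case base
    then obtain a where a: "q = mconst a" using vars_in_empty_imp[of q] by auto
    show ?case
    proof (rule ccontr)
      assume "q \<noteq> 0"
      then have "a \<noteq> 0" using a by auto
      have "mconst (inverse a) * mconst a \<in> P k"
        using primeideal_gen_subalgebraD(5)[OF prime[of k] constA] base a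
        by (simp add: coeff_hom.ev_mconst[OF coeff_hom_mconst])
      then show False
        using \<open>a \<noteq> 0\<close> primeideal_gen_subalgebraD(3)[OF prime[of k]] by (simp flip: mconst_mult)
    qed
  next
    case (step i)
    note IH = step.IH
    have "i < k" by fact
    note Pi = primeideal_gen_subalgebraD[OF prime[of i]] primeideal_gen_subalgebraD[OF prime[of "Suc i"]]
    \<comment> \<open>A power of the variable may divide \<open>q\<close>; each cancellation lowers
      the degree in that variable by one.\<close>
    from step.prems show "q = 0"
    proof (induction "degree (poly_in_var i q)" arbitrary: q rule: less_induct)
      case less
      have ins: "{i..<k} = insert i {Suc i..<k}" using \<open>i < k\<close> by auto
      then obtain q0 r where q: "q = q0 + pvar i * r" "vars_in {Suc i..<k} q0" "vars_in {i..<k} r"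
        using split_variable[of i "{Suc i..<k}" q] less.prems(1) by auto
      have ev: "ev mconst x q = ev mconst x q0 + x i * ev mconst x r"
        by (simp add: q(1) coeff_hom.ev_add[OF coeff_hom_mconst] coeff_hom.ev_mult[OF coeff_hom_mconst]
            coeff_hom.ev_pvar[OF coeff_hom_mconst])
      have rA: "ev mconst x r \<in> gen_subalgebra h" using q(3) by (rule evA)
      have "ev mconst x r * x i \<in> P (Suc i)"
        using Pi(11)[OF _ rA, of "x i"] x[OF \<open>i < k\<close>] \<open>i < k\<close> by simp
      then have "mconst (-1) * (ev mconst x r * x i) \<in> P (Suc i)"
        using Pi(11)[OF _ constA] \<open>i < k\<close> by simp
      then have "ev mconst x q + mconst (-1) * (ev mconst x r * x i) \<in> P (Suc i)"
        using Pi(10)[of "ev mconst x q"] less.prems(2) sub[OF \<open>i < k\<close>] \<open>i < k\<close> by (auto simp: Suc_le_eq)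
      then have "ev mconst x q0 \<in> P (Suc i)"
        by (simp add: ev coeff_hom.hom_uminus[OF coeff_hom_mconst] mult.commute)
      then have "q0 = 0" using IH[of q0] q(2) by blast
      then have qr: "q = pvar i * r" using q(1) by simp
      have "x i \<in> P i \<or> ev mconst x r \<in> P i"
        using Pi(6)[OF _ xA[OF \<open>i < k\<close>] rA] less.prems(2) \<open>i < k\<close>
        by (simp add: ev \<open>q0 = 0\<close> coeff_hom.ev_0[OF coeff_hom_mconst])
      then have rP: "ev mconst x r \<in> P i" using x[OF \<open>i < k\<close>] by blast
      show ?case
      proof (cases "r = 0")
        case False
        have "pvar i \<noteq> (0 :: (nat, 'a) mpoly)" by (metis poly_in_var_0 poly_in_var_pvar pCons_eq_0_iff zero_neq_one)
        then have "degree (poly_in_var i q) = 1 + degree (poly_in_var i r)"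
          using False by (simp add: qr degree_poly_in_var_mult poly_in_var_pvar)
        then have "r = 0" using less.hyps[of r] q(3) rP by simp
        then show ?thesis using qr by simp
      qed (simp add: qr)
    qed
  qed
  note main = this[of 0]
  show ?thesis
    unfolding alg_indep_family_def
  proof (intro allI impI)
    fix q :: "(nat, 'a) mpoly"
    assume q: "vars_in {..<k} q" "fract_ev (\<lambda>i. to_fract (x i)) q = 0"
    have "to_fract (ev mconst x q) = 0"
      unfolding hom_ev[OF coeff_hom_mconst coeff_hom_to_fract] using q(2) by (simp add: const_fract_def[abs_def])
    then show "q = 0"
      using main[of q] q(1) primeideal_gen_subalgebraD(2)[OF prime[of 0]] by (simp add: lessThan_atLeast0)
  qed
qed

lemma krull_dim_le_tr_deg:
  fixes h :: "(('n::{finite,linorder}, 'a::field) mpoly, 'n) vec"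
  shows "krull_dim (ring_of_type_algebra\<lparr>carrier := gen_subalgebra h\<rparr>) \<le> tr_deg const_field (gen_subfield h)"
  unfolding krull_dim_def
proof (rule Sup_least)
  fix e
  assume "e \<in> {enat k |k. \<exists>P. (\<forall>i\<le>k. primeideal (P i) (ring_of_type_algebra\<lparr>carrier := gen_subalgebra h\<rparr>)) \<and>
    (\<forall>i<k. P i \<subset> P (Suc i))}"
  then obtain k P where e: "e = enat k"
    and P: "\<forall>i\<le>k. primeideal (P i) (ring_of_type_algebra\<lparr>carrier := gen_subalgebra h\<rparr>)" "\<forall>i<k. P i \<subset> P (Suc i)"
    by blast
  have "\<forall>i. \<exists>x. i < k \<longrightarrow> x \<in> P (Suc i) - P i" using P(2) by blast
  then obtain x where x: "\<And>i. i < k \<Longrightarrow> x i \<in> P (Suc i) - P i" by metis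
  have mono: "P i \<subseteq> P j" if "i \<le> j" "j \<le> k" for i j
    using that by (induction j rule: dec_induct) (use P(2) in \<open>auto simp: Suc_le_eq\<close>)
  \<comment> \<open>\<open>x i\<close> lies in \<open>P (Suc i)\<close> and hence in
    \<open>P j\<close>, which \<open>x j\<close> avoids.\<close>
  have neq: "x i \<noteq> x j" if "i < j" "j < k" for i j
    using x[of i] x[of j] mono[of "Suc i" j] that by auto
  have inj: "inj_on (\<lambda>i. to_fract (x i)) {..<k}"
    by (rule inj_onI) (metis neq lessThan_iff linorder_neq_iff to_fract_eq_iff)
  have "alg_indep_family {..<k} (\<lambda>i. to_fract (x i))"
    using P x by (intro prime_chain_alg_indep[of k P h]) auto
  then have "alg_independent const_field ((\<lambda>i. to_fract (x i)) ` {..<k})"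
    using alg_indep_family_image[OF inj] by (simp add: alg_independent_const_field)
  moreover have "(\<lambda>i. to_fract (x i)) ` {..<k} \<subseteq> gen_subfield h"
  proof (rule image_subsetI)
    fix i assume "i \<in> {..<k}"
    then have "x i \<in> P (Suc i)" "P (Suc i) \<subseteq> gen_subalgebra h"
      using x[of i] P(1) primeideal_gen_subalgebraD(1)[of "P (Suc i)" h] by auto
    then show "to_fract (x i) \<in> gen_subfield h" using gen_subalgebra_to_fract by blast
  qed
  moreover have "card ((\<lambda>i. to_fract (x i)) ` {..<k}) = k" using inj by (simp add: card_image)
  ultimately show "e \<le> tr_deg const_field (gen_subfield h)"
    unfolding e tr_deg_def by (intro Sup_upper) (auto intro!: exI[of _ "(\<lambda>i. to_fract (x i)) ` {..<k}"])
qed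

section \<open>A chain of primes of length the rank\<close>

text \<open>Restricted to a line parallel to a coordinate axis, \<open>q\<close> is a univariate
  polynomial with infinitely many zeros, so its derivative vanishes too. Hence all partial
  derivatives have only zero values, and induction on the degree makes \<open>q\<close>
  constant.\<close>

lemma mpoly_eq_0_if_all_values_0:
  fixes q :: "('i::finite, 'a::{idom,ring_char_0}) mpoly"
  assumes "\<And>v. ev (\<lambda>a. a) v q = 0"
  shows "q = 0"
proof -
  have "q = 0" if "degree_le d q" "\<And>v. ev (\<lambda>a. a) v q = 0" for d
    using that
  proof (induction d arbitrary: q rule: less_induct)
    case (less d)
    have "ev (\<lambda>a. a) v (partial_deriv k q) = 0" for v k
    proof -
      define E where "E = ev (\<lambda>a. [:a:]) (\<lambda>i. [:v i, if i = k then 1 else 0:] :: 'a poly)"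
      have E: "coeff_hom E" unfolding E_def by (rule coeff_hom.coeff_hom_ev[OF coeff_hom_const_poly])
      have E_const: "E (mconst a) = [:a:]" for a
        by (simp add: E_def coeff_hom.ev_mconst[OF coeff_hom_const_poly])
      have E_pvar: "E (pvar i) = [:v i, if i = k then 1 else 0:]" for i
        by (simp add: E_def coeff_hom.ev_pvar[OF coeff_hom_const_poly])
      have val: "poly (E p) c = ev (\<lambda>a. a) (\<lambda>i. v i + (if i = k then c else 0)) p" for p c
      proof -
        have "(\<lambda>i. poly [:v i, if i = k then 1 else 0:] c) = (\<lambda>i. v i + (if i = k then c else 0))"
          by (simp add: fun_eq_iff)
        then show ?thesis unfolding E_def hom_ev[OF coeff_hom_const_poly coeff_hom_poly] by simp
      qed
      have "pderiv (E q) = (\<Sum>i\<in>UNIV. E (partial_deriv i q) * pderiv (E (pvar i)))"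
        by (rule derivation_eq[OF _ vars_in_UNIV E])
          (auto simp: coeff_hom.hom_add[OF E] coeff_hom.hom_mult[OF E] pderiv_add pderiv_mult E_const pderiv_pCons)
      also have "\<dots> = E (partial_deriv k q)"
      proof -
        have "E (partial_deriv i q) * pderiv (E (pvar i)) = (if i = k then E (partial_deriv i q) else 0)" for i
          by (simp add: E_pvar pderiv_pCons)
        then show ?thesis by simp
      qed
      moreover have "E q = 0"
      proof -
        have "\<forall>c. poly (E q) c = 0" by (simp add: val less.prems(2))
        then show ?thesis using poly_all_0_iff_0 by blast
      qed
      ultimately have "E (partial_deriv k q) = 0" by simp
      then show ?thesis using val[of "partial_deriv k q" 0] by simp
    qed
    note vals = this
    have "partial_deriv k q = 0" for k
    proof (rule ccontr)
      assume nz: "partial_deriv k q \<noteq> 0"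
      then have "d - 1 < d" "degree_le (d - 1) (partial_deriv k q)"
        using degree_le_partial_deriv[OF less.prems(1), of k] by auto
      then have "partial_deriv k q = 0" by (rule less.IH) (rule vals)
      with nz show False ..
    qed
    then have "vars_in (UNIV - {k}) q" for k by (rule partial_deriv_eq_0_imp)
    then have "vars_in {} q" by (rule vars_inI)
    then obtain a where a: "q = mconst a" using vars_in_empty_imp by blast
    then show ?case using less.prems(2)[of "\<lambda>_. 0"] by (simp add: coeff_hom.ev_mconst[OF coeff_hom_id])
  qed
  then show ?thesis using assms degree_le_exists by blast
qed

lemma det_hom:
  assumes "coeff_hom f"
  shows "det (\<chi> i j. f (A $ i $ j)) = f (det (A :: ('a::comm_ring_1 ^ 'n ^ 'n)))"
proof -
  interpret coeff_hom f by fact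
  have "f (of_int k) = of_int k" for k
    by (cases k rule: int_diff_cases) (simp add: hom_diff hom_of_nat)
  then show ?thesis by (simp add: det_def hom_sum hom_mult hom_prod)
qed

lemma det_ne_0_left_kernel:
  fixes A :: "'f::field ^ 'n ^ 'n"
  assumes "det A \<noteq> 0" "\<And>j. (\<Sum>i\<in>UNIV. c i * A $ i $ j) = 0"
  shows "c i = 0"
proof -
  have "\<forall>x. transpose A *v x = 0 \<longrightarrow> x = 0"
    using assms(1) invertible_det_nz[of "transpose A"]
    unfolding invertible_left_inverse matrix_left_invertible_ker det_transpose by blast
  moreover have "transpose A *v (\<chi> i. c i) = 0"
    using assms(2) by (simp add: vec_eq_iff matrix_vector_mult_def transpose_def mult.commute)
  ultimately have "(\<chi> i. c i) = 0" by blast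
  then show ?thesis by (simp add: vec_eq_iff)
qed

text \<open>A linear map sending the independent rows to unit vectors exists; its matrix provides
  vectors dual to these rows.\<close>

lemma independent_rows_dual:
  fixes A :: "('f::field, 'n::finite) vec ^ 'm::finite"
  assumes "inj_on (\<lambda>i. row i A) I" "vec.independent ((\<lambda>i. row i A) ` I)"
  shows "\<exists>W :: 'm \<Rightarrow> 'n \<Rightarrow> 'f. \<forall>i\<in>I. \<forall>a. (\<Sum>j\<in>UNIV. A $ i $ j * W a j) = (if i = a then 1 else 0)"
proof -
  obtain g where g: "Vector_Spaces.linear (*s) (*s) g"
    "\<forall>x\<in>(\<lambda>i. row i A) ` I. g x = (axis (the_inv_into I (\<lambda>i. row i A) x) 1 :: 'f ^ 'm)"
    using vec.linear_independent_extend[OF assms(2),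
        of "\<lambda>x. axis (the_inv_into I (\<lambda>i. row i A) x) 1"] by blast
  have "(\<Sum>j\<in>UNIV. A $ i $ j * matrix g $ a $ j) = (if i = a then 1 else 0)" if "i \<in> I" for i a
  proof -
    have "g (row i A) = axis i 1"
      using g(2) that the_inv_into_f_f[OF assms(1) that] by simp
    then have "matrix g *v row i A = axis i 1" by (simp add: matrix_works[OF g(1)])
    then have "(matrix g *v row i A) $ a = axis i 1 $ a" by simp
    then show ?thesis
      by (cases "i = a") (simp_all add: matrix_vector_mult_def row_def axis_def mult.commute)
  qed
  then show ?thesis by (intro exI[of _ "\<lambda>a j. matrix g $ a $ j"]) auto
qed

lemma common_denominator:
  fixes W :: "'i \<Rightarrow> 'r::idom fract"
  assumes "finite A"
  shows "\<exists>g w. g \<noteq> 0 \<and> (\<forall>i\<in>A. to_fract (w i) = to_fract g * W i)"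
  using assms
proof induction
  case empty
  show ?case by (intro exI[of _ 1] exI) auto
next
  case (insert k A)
  then obtain g w where gw: "g \<noteq> 0" "\<forall>i\<in>A. to_fract (w i) = to_fract g * W i" by blast
  obtain a b where ab: "W k = Fract a b" "b \<noteq> 0" by (rule Fract_cases)
  define w' where "w' i = (if i = k then g * a else b * w i)" for i
  have "to_fract (w' i) = to_fract (b * g) * W i" if "i \<in> insert k A" for i
    using that gw(2) ab by (auto simp: w'_def Fract_conv_to_fract)
  then show ?case using gw(1) ab(2) by (intro exI[of _ "b * g"] exI[of _ w']) auto
qed

text \<open>\<open>K s\<close> is the kernel of restriction to an s-dimensional affine subspace
  spanned by directions dual to rows of the Jacobian matrix at a point. On that subspace s of the
  components stay independent, whereas any s + 1 functions are dependent. A relation between s + 1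
  components on the s-dimensional space thus gives an element of \<open>K s\<close> outside
  \<open>K (Suc s)\<close>.\<close>

lemma rank_le_krull_dim:
  fixes h :: "(('n::{finite,linorder}, 'a::field_char_0) mpoly, 'n) vec"
  shows "enat (rank (jacobian h)) \<le> krull_dim (ring_of_type_algebra\<lparr>carrier := gen_subalgebra h\<rparr>)"
proof -
  define r where "r = rank (jacobian h)"
  obtain I where I: "card I = r" "inj_on (\<lambda>i. row i (jacobian h)) I"
    "vec.independent ((\<lambda>i. row i (jacobian h)) ` I)"
    unfolding r_def by (rule independent_rows_of_rank)
  obtain W where W: "\<forall>i\<in>I. \<forall>a. (\<Sum>j\<in>UNIV. jacobian h $ i $ j * W a j) = (if i = a then 1 else 0)"
    using independent_rows_dual[OF I(2,3)] by blast
  obtain g w where gw: "g \<noteq> 0" "\<And>x. to_fract (w x) = to_fract g * (case x of (a, j) \<Rightarrow> W a j)"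
    using common_denominator[of UNIV "\<lambda>(a, j). W a j"] by auto
  have Jw: "(\<Sum>j\<in>UNIV. partial_deriv j (h $ i) * w (a, j)) = (if i = a then g else 0)" if "i \<in> I" for i a
  proof -
    have "to_fract (\<Sum>j\<in>UNIV. partial_deriv j (h $ i) * w (a, j)) =
        to_fract g * (\<Sum>j\<in>UNIV. jacobian h $ i $ j * W a j)"
      by (simp add: gw(2) jacobian_def sum_distrib_left mult_ac)
    also have "\<dots> = to_fract (if i = a then g else 0)" using W that by simp
    finally show ?thesis by (simp del: to_fract_sum)
  qed
  \<comment> \<open>The common denominator of the dual vectors does not vanish at \<open>p\<close>,
    so they can be specialised there.\<close>
  obtain p where p: "ev (\<lambda>a. a) p g \<noteq> 0" using mpoly_eq_0_if_all_values_0[of g] gw(1) by blast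
  let ?at = "ev (\<lambda>a. a) p"
  define u where "u a j = ?at (w (a, j)) / ?at g" for a j
  have at: "coeff_hom ?at" by (rule coeff_hom.coeff_hom_ev[OF coeff_hom_id])
  have Ju: "(\<Sum>j\<in>UNIV. ?at (partial_deriv j (h $ i)) * u a j) = (if i = a then 1 else 0)" if "i \<in> I" for i a
    using arg_cong[OF Jw[OF that, of a], of ?at] p
    by (simp add: u_def coeff_hom.hom_sum[OF at] coeff_hom.hom_mult[OF at] coeff_hom.hom_0[OF at]
        flip: sum_divide_distrib split: if_splits)
  obtain e where e: "bij_betw e {..<r} I" using I(1) finite_same_card_bij[of "{..<r}" I] by auto
  have inj_e: "inj_on e {..<r}" and img_e: "e ` {..<r} = I" using e by (auto simp: bij_betw_def)
  \<comment> \<open>Affine parametrization through \<open>p\<close> along the first \<open>s\<close>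
    dual directions; the variable of index \<open>a\<close> serves as the coordinate along
    \<open>u a\<close>.\<close>
  define \<gamma> :: "nat \<Rightarrow> 'n \<Rightarrow> ('n, 'a) mpoly" where
    "\<gamma> s j = mconst (p j) + (\<Sum>a\<in>e ` {..<s}. mconst (u a j) * pvar a)" for s j
  define \<sigma> where "\<sigma> s = ev mconst (\<gamma> s)" for s
  note hm = coeff_hom_mconst
  have \<sigma>: "coeff_hom (\<sigma> s)" for s unfolding \<sigma>_def by (rule coeff_hom.coeff_hom_ev[OF hm])
  have \<sigma>_const: "\<sigma> s (mconst a) = mconst a" for s a by (simp add: \<sigma>_def coeff_hom.ev_mconst[OF hm])
  have \<sigma>_pvar: "\<sigma> s (pvar j) = \<gamma> s j" for s j by (simp add: \<sigma>_def coeff_hom.ev_pvar[OF hm])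
  \<comment> \<open>Evaluation at the origin of the parameter space, which corresponds to the point
    \<open>p\<close>.\<close>
  define \<epsilon> where "\<epsilon> = ev (\<lambda>a. a) (\<lambda>_::'n. 0::'a)"
  have \<epsilon>: "coeff_hom \<epsilon>" unfolding \<epsilon>_def by (rule coeff_hom.coeff_hom_ev[OF coeff_hom_id])
  have \<epsilon>_const: "\<epsilon> (mconst a) = a" for a by (simp add: \<epsilon>_def coeff_hom.ev_mconst[OF coeff_hom_id])
  have \<epsilon>_pvar: "\<epsilon> (pvar i) = 0" for i by (simp add: \<epsilon>_def coeff_hom.ev_pvar[OF coeff_hom_id])
  have \<epsilon>\<gamma>: "\<epsilon> (\<gamma> s j) = p j" for s j
    by (simp add: \<gamma>_def coeff_hom.hom_add[OF \<epsilon>] coeff_hom.hom_sum[OF \<epsilon>] coeff_hom.hom_mult[OF \<epsilon>] \<epsilon>_const \<epsilon>_pvar)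
  have \<epsilon>\<sigma>: "\<epsilon> (\<sigma> s q) = ?at q" for s q
    unfolding \<sigma>_def hom_ev[OF hm \<epsilon>] by (simp add: \<epsilon>_const \<epsilon>\<gamma>)
  have d\<gamma>: "partial_deriv a (\<gamma> s j) = mconst (u a j)" if "a \<in> e ` {..<s}" for a s j
  proof -
    have "partial_deriv a (\<gamma> s j) = (\<Sum>b\<in>e ` {..<s}. mconst (u b j) * partial_deriv a (pvar b))"
      by (simp add: \<gamma>_def partial_deriv_add partial_deriv_sum partial_deriv_mult)
    also have "\<dots> = (\<Sum>b\<in>e ` {..<s}. if a = b then mconst (u b j) else 0)"
      by (rule sum.cong) (auto simp: partial_deriv_pvar)
    also have "\<dots> = mconst (u a j)" using that by simp
    finally show ?thesis .
  qed
  have d\<sigma>: "\<epsilon> (partial_deriv a (\<sigma> s (h $ i))) = (if i = a then 1 else 0)"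
    if "s \<le> r" "a \<in> e ` {..<s}" "i \<in> e ` {..<s}" for a i s
  proof -
    have i: "i \<in> I" using that img_e by auto
    have "partial_deriv a (\<sigma> s (h $ i)) =
        (\<Sum>j\<in>UNIV. \<sigma> s (partial_deriv j (h $ i)) * partial_deriv a (\<sigma> s (pvar j)))"
      by (rule derivation_eq[OF _ vars_in_UNIV \<sigma>])
        (auto simp: coeff_hom.hom_add[OF \<sigma>] coeff_hom.hom_mult[OF \<sigma>] partial_deriv_add partial_deriv_mult
          \<sigma>_const)
    also have "\<dots> = (\<Sum>j\<in>UNIV. \<sigma> s (partial_deriv j (h $ i)) * mconst (u a j))"
      using d\<gamma>[OF that(2)] by (simp add: \<sigma>_pvar)
    finally show ?thesis
      using Ju[OF i, of a] by (simp add: coeff_hom.hom_sum[OF \<epsilon>] coeff_hom.hom_mult[OF \<epsilon>] \<epsilon>_const \<epsilon>\<sigma>)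
  qed
  have indep: "alg_indep_family (e ` {..<s}) (\<lambda>i. to_fract (\<sigma> s (h $ i)))" if s: "s \<le> r" for s
  proof (rule alg_indep_family_of_gradients)
    let ?E = "e ` {..<s}"
    fix c assume c: "\<And>j. (\<Sum>i\<in>?E. c i * fract_deriv j (to_fract (\<sigma> s (h $ i)))) = 0"
    \<comment> \<open>The Jacobian block of the restricted components, padded by an identity block
      to a full square matrix. By duality it becomes the identity at the origin, so its determinant
      is a nonzero polynomial.\<close>
    define N :: "((('n, 'a) mpoly, 'n) vec, 'n) vec" where
      "N = (\<chi> i j. if i \<in> ?E \<and> j \<in> ?E then partial_deriv j (\<sigma> s (h $ i)) else if i = j then 1 else 0)"
    define c' where "c' i = (if i \<in> ?E then c i else 0)" for i
    have "\<epsilon> (det N) = det (\<chi> i j. \<epsilon> (N $ i $ j))" by (simp add: det_hom[OF \<epsilon>])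
    also have "(\<chi> i j. \<epsilon> (N $ i $ j)) = mat 1"
      using d\<sigma>[OF s] by (auto simp: vec_eq_iff N_def mat_def coeff_hom.hom_0[OF \<epsilon>] coeff_hom.hom_1[OF \<epsilon>])
    finally have "det N \<noteq> 0" using coeff_hom.hom_0[OF \<epsilon>] by auto
    then have "det (\<chi> i j. to_fract (N $ i $ j)) \<noteq> 0" by (simp add: det_hom[OF coeff_hom_to_fract])
    moreover have "(\<Sum>i\<in>UNIV. c' i * (\<chi> i j. to_fract (N $ i $ j)) $ i $ j) = 0" for j
    proof -
      have "(\<Sum>i\<in>UNIV. c' i * (\<chi> i j. to_fract (N $ i $ j)) $ i $ j) = (\<Sum>i\<in>?E. c i * to_fract (N $ i $ j))"
        by (rule sum.mono_neutral_cong_right) (auto simp: c'_def)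
      also have "\<dots> = 0"
      proof (cases "j \<in> ?E")
        case True
        then show ?thesis using c[of j] by (simp add: N_def)
      next
        case False
        then show ?thesis by (intro sum.neutral) (auto simp: N_def)
      qed
      finally show ?thesis .
    qed
    ultimately have "c' i = 0" for i by (rule det_ne_0_left_kernel)
    then show "\<forall>i\<in>?E. c i = 0" unfolding c'_def by meson
  qed simp
  define K where "K s = {x \<in> gen_subalgebra h. \<sigma> s x = 0}" for s
  have prime: "primeideal (K s) (ring_of_type_algebra\<lparr>carrier := gen_subalgebra h\<rparr>)" for s
    unfolding K_def by (rule primeideal_gen_subalgebraI[OF \<sigma>])
  have strict: "K (Suc s) \<subset> K s" if s: "s < r" for s
  proof
    \<comment> \<open>Setting the newest parameter to zero turns restriction to the larger subspace
      into restriction to the smaller one, so the kernels are nested.\<close>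
    define \<theta> where "\<theta> = ev mconst (\<lambda>a. if a = e s then 0 else pvar a :: ('n, 'a) mpoly)"
    have \<theta>: "coeff_hom \<theta>" unfolding \<theta>_def by (rule coeff_hom.coeff_hom_ev[OF hm])
    have es: "e s \<notin> e ` {..<s}" using inj_onD[OF inj_e, of s] s by fastforce
    have "\<theta> (\<gamma> (Suc s) j) = \<gamma> s j" for j
    proof -
      have "\<theta> (\<gamma> (Suc s) j) = mconst (p j) + (\<Sum>a\<in>e ` {..<Suc s}. mconst (u a j) * (if a = e s then 0 else pvar a))"
        by (simp add: \<gamma>_def coeff_hom.hom_add[OF \<theta>] coeff_hom.hom_sum[OF \<theta>] coeff_hom.hom_mult[OF \<theta>])
          (simp add: \<theta>_def coeff_hom.ev_mconst[OF hm] coeff_hom.ev_pvar[OF hm])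
      also have "(\<Sum>a\<in>e ` {..<Suc s}. mconst (u a j) * (if a = e s then 0 else pvar a)) =
          (\<Sum>a\<in>e ` {..<s}. mconst (u a j) * (if a = e s then 0 else pvar a))"
        by (rule sum.mono_neutral_right) (auto simp: less_Suc_eq)
      also have "\<dots> = (\<Sum>a\<in>e ` {..<s}. mconst (u a j) * pvar a)"
      proof (rule sum.cong)
        fix x assume "x \<in> e ` {..<s}"
        then have "x \<noteq> e s" using es by blast
        then show "mconst (u x j) * (if x = e s then 0 else pvar x) = mconst (u x j) * pvar x" by simp
      qed simp
      finally show ?thesis by (simp add: \<gamma>_def)
    qed
    then have "\<theta> (\<sigma> (Suc s) q) = \<sigma> s q" for q
      unfolding \<sigma>_def hom_ev[OF hm \<theta>] by (simp add: \<theta>_def coeff_hom.ev_mconst[OF hm])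
    note \<theta>\<sigma> = this
    show "K (Suc s) \<subseteq> K s"
    proof
      fix x assume "x \<in> K (Suc s)"
      then show "x \<in> K s" using \<theta>\<sigma>[of x] coeff_hom.hom_0[OF \<theta>] by (simp add: K_def)
    qed
    have "inj_on e {..<Suc s}" using inj_e by (rule inj_on_subset) (use s in auto)
    then have card: "card (e ` {..<s}) < card (e ` {..<Suc s})"
      by (simp add: card_image inj_on_subset[of e "{..<Suc s}" "{..<s}"])
    have "\<not> alg_indep_family (e ` {..<Suc s}) (\<lambda>i. to_fract (\<sigma> s (h $ i)))"
    proof (rule alg_dependent_of_card[OF _ _ card, of 1 "\<lambda>i. \<sigma> s (h $ i)"])
      show "vars_in (e ` {..<s}) (\<sigma> s (h $ i))" for i
        unfolding \<sigma>_def by (rule vars_in_ev[OF hm vars_in_UNIV]) (auto simp: \<gamma>_def)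
    qed simp_all
    then obtain q where q: "vars_in (e ` {..<Suc s}) q" "fract_ev (\<lambda>i. to_fract (\<sigma> s (h $ i))) q = 0" "q \<noteq> 0"
      unfolding alg_indep_family_def by blast
    have "to_fract (\<sigma> t (ev mconst (($) h) q)) = fract_ev (\<lambda>i. to_fract (\<sigma> t (h $ i))) q" for t
    proof -
      show ?thesis
        unfolding hom_ev[OF hm coeff_hom_comp[OF coeff_hom_to_fract \<sigma>]] by (simp add: const_fract_def[abs_def] \<sigma>_const)
    qed
    note * = this
    have "\<sigma> s (ev mconst (($) h) q) = 0" using *[of s] q(2) by simp
    moreover have "\<sigma> (Suc s) (ev mconst (($) h) q) \<noteq> 0"
    proof
      assume "\<sigma> (Suc s) (ev mconst (($) h) q) = 0"
      then have "fract_ev (\<lambda>i. to_fract (\<sigma> (Suc s) (h $ i))) q = 0" using *[of "Suc s"] by simp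
      then show False using indep[of "Suc s"] s q(1,3) unfolding alg_indep_family_def by simp
    qed
    ultimately have "ev mconst (($) h) q \<in> K s - K (Suc s)" by (auto simp: K_def gen_subalgebra_eq)
    then show "K (Suc s) \<noteq> K s" by blast
  qed
  \<comment> \<open>The kernels shrink as the subspaces grow, so the ascending chain lists them
    backwards.\<close>
  have "\<forall>i<r. K (r - i) \<subset> K (r - Suc i)"
  proof (intro allI impI)
    fix i assume "i < r"
    then show "K (r - i) \<subset> K (r - Suc i)" using strict[of "r - Suc i"] by (simp add: Suc_diff_Suc)
  qed
  then show ?thesis
    unfolding krull_dim_def r_def[symmetric] using prime
    by (intro Sup_upper) (auto intro!: exI[of _ "\<lambda>i. K (r - i)"])
qed

section \<open>Homogeneous polynomials and the flow of a derivation\<close>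

lemma scaling_poly_eq_sum:
  fixes p :: "('n::finite, 'a::comm_ring_1) mpoly"
  shows "scaling_poly p = (\<Sum>m\<in>Poly_Mapping.keys p.
    monom (Poly_Mapping.single m (Poly_Mapping.lookup p m)) (\<Sum>i\<in>UNIV. Poly_Mapping.lookup m i))"
proof -
  have pow: "[:0, x:] ^ k = monom (x ^ k) k" for x :: "('n, 'a) mpoly" and k
    by (induction k) (simp_all add: monom_Suc monom_0 one_pCons smult_monom)
  have prod: "(\<Prod>i\<in>A. monom (f i) (g i)) = monom (\<Prod>i\<in>A. f i) (\<Sum>i\<in>A. g i)"
    if "finite A" for A :: "'n set" and f :: "'n \<Rightarrow> ('n, 'a) mpoly" and g
    using that by (induction A) (auto simp: monom_0 one_pCons mult_monom)
  have "monomial_value (\<lambda>i. [:0, pvar i:]) m =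
      monom (monomial_value pvar m :: ('n, 'a) mpoly) (\<Sum>i\<in>UNIV. Poly_Mapping.lookup m i)" for m :: "'n \<Rightarrow>\<^sub>0 nat"
    by (simp add: monomial_value_superset[of UNIV] pow prod)
  then show ?thesis
    unfolding scaling_poly_def ev_def by (simp add: smult_monom single_eq_monomial_value)
qed

text \<open>Expresses homogeneity as p(t x) = t^d p(x), so that Euler's identity and the homogeneity
  of factors become questions about polynomials in t.\<close>

lemma homogeneous_iff_scaling_poly:
  fixes p :: "('n::finite, 'a::comm_ring_1) mpoly"
  shows "homogeneous d p \<longleftrightarrow> scaling_poly p = monom p d"
proof
  assume hom: "homogeneous d p"
  have "scaling_poly p = (\<Sum>m\<in>Poly_Mapping.keys p. monom (Poly_Mapping.single m (Poly_Mapping.lookup p m)) d)"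
    unfolding scaling_poly_eq_sum using hom by (intro sum.cong) (auto simp: homogeneous_def)
  also have "\<dots> = monom p d" by (simp add: mpoly_sum_single[symmetric] flip: monom_sum)
  finally show "scaling_poly p = monom p d" .
next
  assume eq: "scaling_poly p = monom p d"
  show "homogeneous d p"
    unfolding homogeneous_def
  proof (rule ballI, rule ccontr)
    fix m assume m: "m \<in> Poly_Mapping.keys p" "(\<Sum>i\<in>UNIV. Poly_Mapping.lookup m i) \<noteq> d"
    let ?e = "\<lambda>m :: 'n \<Rightarrow>\<^sub>0 nat. \<Sum>i\<in>UNIV. Poly_Mapping.lookup m i"
    have "Poly_Mapping.lookup (coeff (scaling_poly p) (?e m)) m =
        (\<Sum>m'\<in>Poly_Mapping.keys p. if m' = m then Poly_Mapping.lookup p m else 0)"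
      unfolding scaling_poly_eq_sum coeff_sum lookup_sum
      by (intro sum.cong) (auto simp: lookup_single when_def)
    also have "\<dots> = Poly_Mapping.lookup p m" using m(1) by simp
    finally show False using m eq by (simp add: in_keys_iff)
  qed
qed

text \<open>The derivative of p(t x) = t^d p(x) with respect to t, at t = 1.\<close>

lemma euler_identity:
  fixes p :: "('n::{finite,linorder}, 'a::idom) mpoly"
  assumes "homogeneous d p"
  shows "(\<Sum>i\<in>UNIV. pvar i * partial_deriv i p) = of_nat d * p"
proof -
  have "pderiv (scaling_poly p) = (\<Sum>i\<in>UNIV. scaling_poly (partial_deriv i p) * pderiv (scaling_poly (pvar i)))"
    by (rule derivation_eq[OF _ vars_in_UNIV coeff_hom_scaling_poly])
      (auto simp: scaling_poly_hom pderiv_add pderiv_mult pderiv_pCons)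
  then have "poly (pderiv (monom p d)) 1 = (\<Sum>i\<in>UNIV. poly (scaling_poly (partial_deriv i p)) 1 * pvar i)"
    using assms by (simp add: homogeneous_iff_scaling_poly poly_sum pderiv_pCons mult.commute)
  then show ?thesis by (simp add: pderiv_monom poly_monom poly_scaling_poly_1 mult.commute)
qed

text \<open>Order at 0 and degree are both additive and agree for the monomial; since the order
  never exceeds the degree, they agree for each factor.\<close>

lemma monom_factor:
  fixes P Q :: "'a::idom poly"
  assumes "P * Q = monom c d" "c \<noteq> 0"
  shows "P = monom (lead_coeff P) (degree P)"
proof -
  have ord: "order 0 (monom c d) = d"
  proof -
    have "order 0 (monom c d) \<le> d"
      using order_degree[of "monom c d" 0] assms(2) by (simp add: degree_monom_eq monom_eq_0_iff)
    moreover have "monom 1 d dvd monom c d" by (simp add: monom_1_dvd_iff')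
    ultimately show ?thesis using assms(2) by (simp add: monom_1_dvd_iff monom_eq_0_iff)
  qed
  have nz: "P * Q \<noteq> 0" using assms by (simp add: monom_eq_0_iff)
  then have "P \<noteq> 0" "Q \<noteq> 0" by auto
  have "order 0 P + order 0 Q = degree P + degree Q"
    using order_mult[OF nz, of 0] degree_mult_eq[OF \<open>P \<noteq> 0\<close> \<open>Q \<noteq> 0\<close>] ord assms
    by (simp add: degree_monom_eq)
  then have "order 0 P = degree P"
    using order_degree[OF \<open>P \<noteq> 0\<close>, of 0] order_degree[OF \<open>Q \<noteq> 0\<close>, of 0] by linarith
  then have "monom 1 (degree P) dvd P" using \<open>P \<noteq> 0\<close> by (simp add: monom_1_dvd_iff)
  then have "coeff P k = 0" if "k < degree P" for k using that by (simp add: monom_1_dvd_iff')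
  then show ?thesis by (intro poly_eqI) (metis coeff_eq_0 coeff_monom linorder_neqE_nat)
qed

lemma homogeneous_factor:
  fixes p q :: "('n::{finite,linorder}, 'a::idom) mpoly"
  assumes "homogeneous d (p * q)" "p * q \<noteq> 0"
  shows "homogeneous (tdeg p) p"
proof -
  have "scaling_poly p = monom (lead_coeff (scaling_poly p)) (tdeg p)"
    by (rule monom_factor) (use assms in \<open>auto simp: homogeneous_iff_scaling_poly scaling_poly_hom\<close>)
  moreover from this have "p = lead_coeff (scaling_poly p)"
    using poly_scaling_poly_1[of p] by (metis mult.right_neutral poly_monom power_one)
  ultimately show ?thesis by (simp add: homogeneous_iff_scaling_poly)
qed

lemma homogeneous_0: "homogeneous d 0"
  by (simp add: homogeneous_def)

lemma tdeg_homogeneous: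
  fixes p :: "('n::{finite,linorder}, 'a::idom) mpoly"
  shows "homogeneous d p \<Longrightarrow> p \<noteq> 0 \<Longrightarrow> tdeg p = d"
  by (simp add: homogeneous_iff_scaling_poly degree_monom_eq)

text \<open>Uses degree bounds instead of degrees, because the factors x_i + t h_i of the flow have
  degree 0 in t when h_i = 0.\<close>

lemma coeff_mult_top:
  fixes P Q :: "'a::comm_semiring_0 poly"
  assumes "degree P \<le> a" "degree Q \<le> b"
  shows "coeff (P * Q) (a + b) = coeff P a * coeff Q b"
proof -
  have "coeff (P * Q) (a + b) = (\<Sum>i\<in>{a}. coeff P i * coeff Q (a + b - i))"
    unfolding coeff_mult
  proof (rule sum.mono_neutral_right)
    show "\<forall>i\<in>{..a + b} - {a}. coeff P i * coeff Q (a + b - i) = 0"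
    proof
      fix i assume "i \<in> {..a + b} - {a}"
      then consider "i > a" | "a + b - i > b" by fastforce
      then show "coeff P i * coeff Q (a + b - i) = 0"
        by cases (use assms in \<open>auto simp: coeff_eq_0\<close>)
    qed
  qed auto
  then show ?thesis by simp
qed

lemma coeff_power_top:
  fixes P :: "'a::comm_semiring_1 poly"
  assumes "degree P \<le> 1"
  shows "degree (P ^ k) \<le> k \<and> coeff (P ^ k) k = coeff P 1 ^ k"
proof (induction k)
  case (Suc k)
  then show ?case
    using coeff_mult_top[of P 1 "P ^ k" k] degree_mult_le[of P "P ^ k"] assms by auto
qed simp

lemma coeff_prod_top:
  fixes P :: "'i \<Rightarrow> 'a::comm_semiring_1 poly"
  assumes "finite A" "\<And>i. i \<in> A \<Longrightarrow> degree (P i) \<le> m i"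
  shows "degree (prod P A) \<le> sum m A \<and> coeff (prod P A) (sum m A) = (\<Prod>i\<in>A. coeff (P i) (m i))"
  using assms
proof induction
  case (insert x A)
  then show ?case
    using coeff_mult_top[of "P x" "m x" "prod P A" "sum m A"] degree_mult_le[of "P x" "prod P A"]
    by (auto intro: order_trans add_mono)
qed simp

section \<open>The derivation along h and its flow\<close>

definition flow :: "(('n::finite, 'a::comm_ring_1) mpoly, 'n) vec \<Rightarrow> ('n, 'a) mpoly \<Rightarrow> ('n, 'a) mpoly poly" where
  "flow h = ev (\<lambda>a. [:mconst a:]) (\<lambda>i. [:pvar i, h $ i:])"

definition lie_deriv :: "(('n::finite, 'a::comm_ring_1) mpoly, 'n) vec \<Rightarrow> ('n, 'a) mpoly \<Rightarrow> ('n, 'a) mpoly" where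
  "lie_deriv h p = (\<Sum>k\<in>UNIV. h $ k * partial_deriv k p)"

lemma coeff_hom_flow: "coeff_hom (flow h)"
  unfolding flow_def by (rule coeff_hom.coeff_hom_ev[OF coeff_hom_const_poly_mconst])

lemma flow_mconst [simp]: "flow h (mconst a) = [:mconst a:]"
  by (simp add: flow_def coeff_hom.ev_mconst[OF coeff_hom_const_poly_mconst])

lemma flow_pvar [simp]: "flow h (pvar i) = [:pvar i, h $ i:]"
  by (simp add: flow_def coeff_hom.ev_pvar[OF coeff_hom_const_poly_mconst])

lemma coeff_flow_0 [simp]: "coeff (flow h p) 0 = p"
proof -
  have "poly (flow h p) 0 = p"
    by (rule hom_eqI[where S = UNIV and g = "\<lambda>x. x" and f = "\<lambda>p. poly (flow h p) 0"])
      (auto intro: coeff_hom_comp coeff_hom_poly coeff_hom_flow coeff_hom_id)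
  then show ?thesis by (simp add: poly_0_coeff_0)
qed

lemma lie_deriv_0 [simp]: "lie_deriv h 0 = 0"
  by (simp add: lie_deriv_def)

lemma lie_deriv_add: "lie_deriv h (p + q) = lie_deriv h p + lie_deriv h q"
  by (simp add: lie_deriv_def partial_deriv_add distrib_left sum.distrib)

lemma lie_deriv_sum: "lie_deriv h (sum f A) = (\<Sum>a\<in>A. lie_deriv h (f a))"
  by (induction A rule: infinite_finite_induct) (auto simp: lie_deriv_add)

lemma lie_deriv_mult: "lie_deriv h (p * q) = p * lie_deriv h q + q * lie_deriv h p"
  by (simp add: lie_deriv_def partial_deriv_mult distrib_left sum.distrib sum_distrib_left mult_ac)

lemma lie_deriv_pvar: "lie_deriv h (pvar i) = h $ i"
  by (simp add: lie_deriv_def partial_deriv_pvar if_distrib cong: if_cong)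

lemma lie_deriv_mconst [simp]: "lie_deriv h (mconst a) = 0"
  by (simp add: lie_deriv_def)

lemma map_poly_lie_deriv_add:
  "map_poly (lie_deriv h) (P + Q) = map_poly (lie_deriv h) P + map_poly (lie_deriv h) Q"
  by (simp add: poly_eq_iff coeff_map_poly lie_deriv_add)

lemma map_poly_lie_deriv_mult:
  "map_poly (lie_deriv h) (P * Q) = P * map_poly (lie_deriv h) Q + Q * map_poly (lie_deriv h) P"
proof (rule poly_eqI)
  fix n
  have "coeff (Q * map_poly (lie_deriv h) P) n = (\<Sum>i\<le>n. coeff Q (n - i) * lie_deriv h (coeff P i))"
    unfolding mult.commute[of Q] coeff_mult by (intro sum.cong) (simp_all add: coeff_map_poly mult.commute)
  then show "coeff (map_poly (lie_deriv h) (P * Q)) n =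
      coeff (P * map_poly (lie_deriv h) Q + Q * map_poly (lie_deriv h) P) n"
    by (simp add: coeff_map_poly coeff_mult lie_deriv_sum lie_deriv_mult sum.distrib)
qed

text \<open>Both sides are derivations along the flow that kill constants, so it suffices to compare
  them on variables. There d/dt and D both give h_i on x_i + t h_i, the latter because D h_i =
  0.\<close>

lemma pderiv_flow:
  fixes h :: "(('n::{finite,linorder}, 'a::idom) mpoly, 'n) vec"
  assumes "\<And>i. lie_deriv h (h $ i) = 0"
  shows "pderiv (flow h p) = map_poly (lie_deriv h) (flow h p)"
proof -
  have "pderiv (flow h p) = (\<Sum>i\<in>UNIV. flow h (partial_deriv i p) * pderiv (flow h (pvar i)))"
    by (rule derivation_eq[OF _ vars_in_UNIV coeff_hom_flow])
      (auto simp: coeff_hom.hom_add[OF coeff_hom_flow] coeff_hom.hom_mult[OF coeff_hom_flow]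
        pderiv_add pderiv_mult pderiv_pCons)
  moreover have "map_poly (lie_deriv h) (flow h p) =
      (\<Sum>i\<in>UNIV. flow h (partial_deriv i p) * map_poly (lie_deriv h) (flow h (pvar i)))"
    by (rule derivation_eq[OF _ vars_in_UNIV coeff_hom_flow])
      (auto simp: coeff_hom.hom_add[OF coeff_hom_flow] coeff_hom.hom_mult[OF coeff_hom_flow]
        map_poly_lie_deriv_mult map_poly_lie_deriv_add map_poly_pCons)
  moreover have "map_poly (lie_deriv h) (flow h (pvar i)) = pderiv (flow h (pvar i))" for i
    using assms by (auto simp: poly_eq_iff coeff_map_poly coeff_pCons pderiv_pCons lie_deriv_pvar split: nat.split)
  ultimately show ?thesis by simp
qed

text \<open>The coefficients c_n of the flow satisfy c_0 = p and (n + 1) c_(n+1) = D c_n. In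
  characteristic zero D p = 0 therefore kills all higher coefficients.\<close>

lemma flow_const_iff:
  fixes h :: "(('n::{finite,linorder}, 'a::field_char_0) mpoly, 'n) vec"
  assumes "\<And>i. lie_deriv h (h $ i) = 0"
  shows "degree (flow h p) = 0 \<longleftrightarrow> lie_deriv h p = 0"
proof -
  have step: "of_nat (Suc n) * coeff (flow h p) (Suc n) = lie_deriv h (coeff (flow h p) n)" for n
    using arg_cong[OF pderiv_flow[OF assms, of p], of "\<lambda>P. coeff P n"] by (simp add: coeff_pderiv coeff_map_poly)
  have cancel: "of_nat (Suc n) * x = 0 \<longleftrightarrow> x = 0" for n and x :: "('n, 'a) mpoly"
    using mconst_of_nat[of "Suc n", where ?'i = 'n and ?'a = 'a] mconst_eq_0_iff[of "of_nat (Suc n) :: 'a"]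
    by (metis mult_eq_0_iff of_nat_eq_0_iff nat.distinct(2))
  show ?thesis
  proof
    assume "degree (flow h p) = 0"
    then have "coeff (flow h p) 1 = 0" by (intro coeff_eq_0) simp
    then show "lie_deriv h p = 0" using step[of 0] by simp
  next
    assume D: "lie_deriv h p = 0"
    have "coeff (flow h p) (Suc n) = 0" for n
    proof (induction n)
      case 0
      then show ?case using step[of 0] D by simp
    next
      case (Suc n)
      then show ?case using step[of "Suc n"] cancel[of "Suc n"] by (metis lie_deriv_0)
    qed
    then show "degree (flow h p) = 0"
      by (metis gr0_implies_Suc leading_coeff_0_iff degree_0 not_gr_zero)
  qed
qed

text \<open>In a monomial of degree d, the power t^d arises only by taking t h_i from every factor
  x_i + t h_i.\<close>

lemma coeff_flow_top:
  fixes p :: "('n::finite, 'a::comm_ring_1) mpoly"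
  assumes "homogeneous d p"
  shows "coeff (flow h p) d = ev mconst (($) h) p"
proof -
  have "coeff (monomial_value (\<lambda>i. [:pvar i, h $ i:]) m) d = monomial_value (($) h) m"
    if "m \<in> Poly_Mapping.keys p" for m
  proof -
    have d: "d = (\<Sum>i\<in>UNIV. Poly_Mapping.lookup m i)" using assms that by (auto simp: homogeneous_def)
    have "degree [:pvar i, h $ i:] \<le> 1" for i by (simp add: degree_pCons_le)
    note top = coeff_power_top[OF this]
    have "coeff (\<Prod>i\<in>UNIV. [:pvar i, h $ i:] ^ Poly_Mapping.lookup m i) (\<Sum>i\<in>UNIV. Poly_Mapping.lookup m i) =
        (\<Prod>i\<in>UNIV. coeff ([:pvar i, h $ i:] ^ Poly_Mapping.lookup m i) (Poly_Mapping.lookup m i))"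
      using top by (intro coeff_prod_top[THEN conjunct2]) auto
    then show ?thesis using top by (simp add: d monomial_value_superset[of UNIV])
  qed
  then show ?thesis by (simp add: flow_def ev_def coeff_sum)
qed

lemma rank_mult_le:
  fixes A :: "'f::field ^ 'n ^ 'm" and B :: "'f ^ 'p ^ 'n"
  shows "rank (A ** B) \<le> rank A"
proof -
  have "rows (A ** B) = (\<lambda>v. transpose B *v v) ` rows A"
    by (auto simp: rows_def row_def matrix_matrix_mult_def matrix_vector_mult_def transpose_def vec_eq_iff mult.commute image_iff)
  then show ?thesis
    unfolding row_rank_def_gen using vec.dim_image_le[OF matrix_vector_mul_linear_gen[of "transpose B"]] by simp
qed

section \<open>Rank bounds for self-vanishing systems\<close>

lemma rank_jacobian_const:
  fixes h :: "(('n::{finite,linorder}, 'a::idom) mpoly, 'n) vec"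
  assumes "\<And>i j. partial_deriv j (h $ i) = 0"
  shows "rank (jacobian h) = 0"
proof -
  have "rows (jacobian h) \<subseteq> vec.span {}"
    using assms by (auto simp: rows_def row_jacobian vec_eq_iff)
  from vec.dim_le_card[OF this] show ?thesis by (simp add: row_rank_def_gen)
qed

lemma homogeneous_0_const:
  fixes p :: "('n::{finite,linorder}, 'a::idom) mpoly"
  assumes "homogeneous 0 p"
  shows "\<exists>a. p = mconst a"
  using tdeg_homogeneous[OF assms] tdeg_0_imp[of p] mconst_0 by metis

lemma rank_jacobian_le:
  fixes h :: "(('n::{finite,linorder}, 'a::field) mpoly, 'n) vec"
  assumes "\<And>i. lie_deriv h (h $ i) = 0"
  shows "rank (jacobian h) \<le> CARD('n) - 1"
proof (cases "h = 0")
  case True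
  then show ?thesis using rank_jacobian_const[of h] by simp
next
  case False
  obtain I where I: "card I = rank (jacobian h)" "inj_on (\<lambda>i. row i (jacobian h)) I"
    "vec.independent ((\<lambda>i. row i (jacobian h)) ` I)" by (rule independent_rows_of_rank)
  have "I \<noteq> UNIV"
  proof
    assume "I = UNIV"
    then obtain W where W: "\<And>i a. (\<Sum>j\<in>UNIV. jacobian h $ i $ j * W a j) = (if i = a then 1 else 0)"
      using independent_rows_dual[OF I(2,3)] by blast
    then have "jacobian h ** (\<chi> j a. W a j) = mat 1"
      by (simp add: matrix_matrix_mult_def vec_eq_iff mat_def)
    then have inv: "(\<chi> j a. W a j) ** jacobian h = mat 1" by (simp add: matrix_left_right_inverse)
    define v :: "(('n, 'a) mpoly fract, 'n) vec" where "v = (\<chi> i. to_fract (h $ i))"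
    have "jacobian h *v v = 0"
    proof -
      have "(\<Sum>k\<in>UNIV. partial_deriv k (h $ i) * h $ k) = 0" for i
        using assms[of i] by (simp add: lie_deriv_def mult.commute)
      from arg_cong[OF this, of to_fract] show ?thesis
        by (simp add: vec_eq_iff matrix_vector_mult_def jacobian_def v_def)
    qed
    then have "v = 0" using inv matrix_left_invertible_ker[of "jacobian h"] by blast
    then show False using False by (simp add: vec_eq_iff v_def)
  qed
  then have "card I < CARD('n)" by (intro psubset_card_mono) auto
  then show ?thesis using I(1) by simp
qed

text \<open>
  If the rank were \<open>n - 1\<close>, the ideal of relations between the \<open>h\<^sub>i\<close> would have height one. It
  contains every \<open>h\<^sub>i\<close>, because the top coefficient in \<open>t\<close> of \<open>h\<^sub>i(x + t h(x)) = h\<^sub>i(x)\<close> is \<open>h\<^sub>i(h)\<close>.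
\<close>

lemma common_factor:
  fixes h :: "(('n::{finite,linorder}, 'a::field_char_0) mpoly, 'n) vec"
  assumes D: "\<And>i. lie_deriv h (h $ i) = 0" and hom: "\<And>i. homogeneous d (h $ i)" and d: "d > 0"
    and nz: "h \<noteq> 0" and rank: "CARD('n) - 1 \<le> rank (jacobian h)"
  shows "\<exists>F. tdeg F > 0 \<and> (\<forall>i. F dvd h $ i)"
proof -
  obtain I where I: "card I = rank (jacobian h)" "inj_on (\<lambda>i. row i (jacobian h)) I"
    "vec.independent ((\<lambda>i. row i (jacobian h)) ` I)" by (rule independent_rows_of_rank)
  have "card I = CARD('n) - 1" using rank I(1) rank_jacobian_le[OF D] by simp
  then have "card (UNIV - I) = 1" by (simp add: card_Diff_subset Suc_le_eq)
  then obtain k where "UNIV - I = {k}" by (auto simp: card_1_singleton_iff)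
  \<comment> \<open>Exactly one index is left out, so the other components are independent and every
    nonzero relation must involve x_k.\<close>
  then have I_eq: "I = UNIV - {k}" by blast
  define \<phi> where "\<phi> = ev mconst (($) h)"
  have \<phi>: "coeff_hom \<phi>" unfolding \<phi>_def by (rule coeff_hom.coeff_hom_ev[OF coeff_hom_mconst])
  have "to_fract (\<phi> G) = fract_ev (\<lambda>i. to_fract (h $ i)) G" for G
    unfolding \<phi>_def hom_ev[OF coeff_hom_mconst coeff_hom_to_fract] by (simp add: const_fract_def[abs_def])
  then have elim: "G = 0" if "vars_in (UNIV - {k}) G" "\<phi> G = 0" for G
    using jacobian_rows_alg_indep[OF I(2,3)] that unfolding alg_indep_family_def I_eq by (metis to_fract_0)
  have \<phi>h: "\<phi> (h $ i) = 0" for i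
    unfolding \<phi>_def coeff_flow_top[OF hom[of i], symmetric]
    using flow_const_iff[OF D, of "h $ i"] D[of i] d by (intro coeff_eq_0) simp
  obtain i0 where i0: "h $ i0 \<noteq> 0" using nz by (auto simp: vec_eq_iff)
  define R where "R G \<longleftrightarrow> G \<noteq> 0 \<and> \<phi> G = 0" for G
  have "R (h $ i0)" using i0 \<phi>h by (simp add: R_def)
  \<comment> \<open>The relations form a prime ideal, so a nonzero one of least degree is
    irreducible.\<close>
  then obtain F where F: "R F" and min: "\<And>G. R G \<Longrightarrow> tdeg F \<le> tdeg G"
    using ex_has_least_nat[of R "h $ i0" tdeg] by blast
  have F0: "F \<noteq> 0" "\<phi> F = 0" using F by (auto simp: R_def)
  have not_const: "tdeg F > 0"
  proof (rule ccontr)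
    assume "\<not> tdeg F > 0"
    then obtain a where "F = mconst a" using tdeg_0_imp by blast
    then show False using F0 by (simp add: \<phi>_def coeff_hom.ev_mconst[OF coeff_hom_mconst])
  qed
  have "irreducible F"
  proof (rule irreducibleI)
    show "\<not> F dvd 1" using not_const by (simp add: is_unit_mpoly_iff)
    fix a b assume ab: "F = a * b"
    have "a \<noteq> 0" "b \<noteq> 0" using F0 ab by auto
    have tdeg: "tdeg F = tdeg a + tdeg b" unfolding ab by (rule tdeg_mult) fact+
    have "\<phi> a = 0 \<or> \<phi> b = 0" using F0(2) by (simp add: ab coeff_hom.hom_mult[OF \<phi>])
    then have "tdeg F \<le> tdeg a \<or> tdeg F \<le> tdeg b"
      using min \<open>a \<noteq> 0\<close> \<open>b \<noteq> 0\<close> by (auto simp: R_def)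
    then show "a dvd 1 \<or> b dvd 1"
      using tdeg \<open>a \<noteq> 0\<close> \<open>b \<noteq> 0\<close> by (auto simp: is_unit_mpoly_iff)
  qed fact
  have deg_k: "degree (poly_in_var k F) > 0"
    using degree_poly_in_var_0_imp[of k F] elim[of F] F0 by blast
  have "F dvd h $ i" for i
  proof (rule ccontr)
    assume "\<not> F dvd h $ i"
    moreover have "insert k (UNIV - {k}) = UNIV" by blast
    ultimately obtain u v where uv: "u * F + v * h $ i \<noteq> 0" "vars_in (UNIV - {k}) (u * F + v * h $ i)"
      using eliminate_variable[OF irreducibles_prime_finite[of "UNIV - {k}"] _ \<open>irreducible F\<close> _ deg_k, of "h $ i"]
      by auto
    \<comment> \<open>Both \<open>F\<close> and \<open>h $ i\<close> are relations, so this is a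
      nonzero relation free of x_k, which is impossible.\<close>
    have "\<phi> (u * F + v * h $ i) = 0"
      by (simp add: coeff_hom.hom_add[OF \<phi>] coeff_hom.hom_mult[OF \<phi>] F0 \<phi>h)
    then show False using elim uv by blast
  qed
  then show ?thesis using not_const by blast
qed

lemma flow_eq_0_iff: "flow h p = 0 \<longleftrightarrow> p = 0"
proof
  assume "flow h p = 0"
  then have "coeff (flow h p) 0 = 0" by simp
  then show "p = 0" by simp
qed (simp add: coeff_hom.hom_0[OF coeff_hom_flow])

text \<open>The kernel of D consists of the polynomials whose flow has degree 0 in t, and these
  degrees add up over products.\<close>

lemma lie_deriv_factor:
  fixes h :: "(('n::{finite,linorder}, 'a::field_char_0) mpoly, 'n) vec"
  assumes D: "\<And>i. lie_deriv h (h $ i) = 0" and pq: "lie_deriv h (p * q) = 0" "p * q \<noteq> 0"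
  shows "lie_deriv h p = 0"
proof -
  have "flow h p \<noteq> 0" "flow h q \<noteq> 0"
    using pq(2) by (auto simp: flow_eq_0_iff)
  then have "degree (flow h p) + degree (flow h q) = degree (flow h (p * q))"
    by (simp add: coeff_hom.hom_mult[OF coeff_hom_flow] degree_mult_eq)
  moreover have "degree (flow h (p * q)) = 0" using flow_const_iff[OF D, of "p * q"] pq(1) by simp
  ultimately show ?thesis using flow_const_iff[OF D, of p] by simp
qed

text \<open>For d > 0, Euler's identity writes g_i itself as a combination of its partial
  derivatives, so the product rule for F g_i has coefficients independent of i and becomes a matrix
  product. For d = 0 the rows are multiples of the gradient of \<open>F\<close>, whence the
  1.\<close>

lemma rank_jacobian_scale:
  fixes g h :: "(('n::{finite,linorder}, 'a::field_char_0) mpoly, 'n) vec"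
  assumes h: "\<And>i. h $ i = F * g $ i" and hom: "\<And>i. homogeneous d (g $ i)"
  shows "rank (jacobian h) \<le> max 1 (rank (jacobian g))"
proof (cases "d = 0")
  case True
  define v where "v = gradient (to_fract F)"
  have "row i (jacobian h) \<in> vec.span {v}" for i
  proof -
    obtain a where "g $ i = mconst a" using homogeneous_0_const hom True by blast
    then have "row i (jacobian h) = to_fract (mconst a) *s v"
      by (simp add: row_jacobian vec_eq_iff v_def h fract_deriv_mult)
    then show ?thesis by (simp add: vec.span_scale vec.span_base)
  qed
  then have "rows (jacobian h) \<subseteq> vec.span {v}" by (auto simp: rows_def)
  from vec.dim_le_card[OF this] have "rank (jacobian h) \<le> 1" by (simp add: row_rank_def_gen)
  then show ?thesis by simp
next
  case False
  define c :: "('n, 'a) mpoly" where "c = mconst (inverse (of_nat d))"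
  have c: "c * (\<Sum>l\<in>UNIV. pvar l * partial_deriv l (g $ i)) = g $ i" for i
  proof -
    have "c * (of_nat d * g $ i) = mconst (inverse (of_nat d) * of_nat d) * g $ i"
      unfolding c_def mconst_mult mconst_of_nat by (rule mult.assoc[symmetric])
    then show ?thesis using False by (simp add: euler_identity[OF hom])
  qed
  \<comment> \<open>F times the identity plus the rank-one matrix (1/d) x (grad F)^T, which accounts
    for the term g_i grad F.\<close>
  define C where "C = (\<chi> l j. to_fract ((if l = j then F else 0) + c * pvar l * partial_deriv j F))"
  have "jacobian h = jacobian g ** C"
  proof -
    have "partial_deriv j (h $ i) =
        (\<Sum>l\<in>UNIV. partial_deriv l (g $ i) * ((if l = j then F else 0) + c * pvar l * partial_deriv j F))" for i j
    proof -
      have "(\<Sum>l\<in>UNIV. partial_deriv l (g $ i) * ((if l = j then F else 0) + c * pvar l * partial_deriv j F)) =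
          (\<Sum>l\<in>UNIV. (if l = j then partial_deriv l (g $ i) * F else 0) +
            c * (pvar l * partial_deriv l (g $ i)) * partial_deriv j F)"
        by (rule sum.cong) (simp_all add: algebra_simps)
      also have "\<dots> = partial_deriv j (g $ i) * F +
          (\<Sum>l\<in>UNIV. c * (pvar l * partial_deriv l (g $ i)) * partial_deriv j F)"
        unfolding sum.distrib by simp
      also have "\<dots> = partial_deriv j (g $ i) * F + g $ i * partial_deriv j F"
        unfolding sum_distrib_right[symmetric] sum_distrib_left[symmetric] c ..
      finally show ?thesis by (simp add: h partial_deriv_mult mult.commute)
    qed
    note entry = this
    show ?thesis
      unfolding vec_eq_iff
    proof (intro allI)
      fix i j
      have "jacobian h $ i $ j = to_fract (partial_deriv j (h $ i))" by (simp add: jacobian_def)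
      also have "\<dots> = (\<Sum>l\<in>UNIV. to_fract (partial_deriv l (g $ i)) *
          to_fract ((if l = j then F else 0) + c * pvar l * partial_deriv j F))"
        unfolding entry by (simp only: to_fract_sum to_fract_mult)
      also have "\<dots> = (jacobian g ** C) $ i $ j"
        by (simp only: jacobian_def matrix_matrix_mult_def C_def vec_lambda_beta)
      finally show "jacobian h $ i $ j = (jacobian g ** C) $ i $ j" .
    qed
  qed
  then show ?thesis using rank_mult_le[of "jacobian g" C] by simp
qed

lemma rank_jacobian_le_2:
  fixes h :: "(('n::{finite,linorder}, 'a::field_char_0) mpoly, 'n) vec"
  assumes "CARD('n) \<ge> 3" "\<And>i. lie_deriv h (h $ i) = 0" "\<And>i. homogeneous d (h $ i)"
  shows "rank (jacobian h) \<le> CARD('n) - 2"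
  using assms(2,3)
proof (induction d arbitrary: h rule: less_induct)
  case (less d)
  note D = less.prems(1) and hom = less.prems(2)
  show ?case
  proof (rule ccontr)
    assume contra: "\<not> rank (jacobian h) \<le> CARD('n) - 2"
    have "d > 0"
    proof (rule ccontr)
      assume "\<not> d > 0"
      then have "\<exists>a. h $ i = mconst a" for i using homogeneous_0_const[of "h $ i"] hom[of i] by simp
      then have "partial_deriv j (h $ i) = 0" for i j by (metis partial_deriv_mconst)
      then have "rank (jacobian h) = 0" by (rule rank_jacobian_const)
      then show False using contra by simp
    qed
    have "h \<noteq> 0" using rank_jacobian_const[of h] contra by auto
    moreover have "CARD('n) - 1 \<le> rank (jacobian h)" using contra by linarith
    ultimately obtain F where F: "tdeg F > 0" "\<forall>i. F dvd h $ i"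
      using common_factor[OF D hom \<open>d > 0\<close>] by blast
    then have "\<forall>i. \<exists>q. h $ i = F * q" by (auto elim: dvdE)
    then obtain g' where g': "\<forall>i. h $ i = F * g' i" by (rule choice[THEN exE])
    define g where "g = (\<chi> i. g' i)"
    have g: "h $ i = F * g $ i" for i using g' by (simp add: g_def)
    have F0: "F \<noteq> 0" using F(1) by auto
    have Dg: "lie_deriv h (g $ i) = 0" for i
      using lie_deriv_factor[OF D, of "g $ i" F] D[of i] F0 by (cases "g $ i = 0") (simp_all add: g mult.commute)
    \<comment> \<open>The derivations along h and g differ by the factor \<open>F\<close>, so being
      killed by one means being killed by the other.\<close>
    have "F * lie_deriv g (g $ i) = 0" for i
      using Dg[of i] by (simp add: lie_deriv_def g sum_distrib_left mult.assoc)
    then have Dgg: "lie_deriv g (g $ i) = 0" for i using F0 by simp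
    \<comment> \<open>Zero components are homogeneous of every degree; the nonzero ones all have the
      same degree because degrees add.\<close>
    have homg: "homogeneous (d - tdeg F) (g $ i)" for i
    proof (cases "g $ i = 0")
      case False
      then have "homogeneous (tdeg (g $ i)) (g $ i)"
        using hom[of i] F0 by (intro homogeneous_factor[of d _ F]) (auto simp: g mult.commute)
      moreover have "tdeg F + tdeg (g $ i) = d"
        using tdeg_homogeneous[OF hom[of i]] tdeg_mult[OF F0 False] F0 False by (simp add: g)
      ultimately show ?thesis by (metis diff_add_inverse)
    qed (simp add: homogeneous_0)
    have "rank (jacobian g) \<le> CARD('n) - 2"
      using less.IH[OF _ Dgg homg] F(1) \<open>d > 0\<close> by simp
    then have "rank (jacobian h) \<le> max 1 (CARD('n) - 2)"
      using rank_jacobian_scale[OF g homg] by linarith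
    \<comment> \<open>For n \<ge> 3 the maximum is n - 2, so the exceptional case of rank one causes
      no loss.\<close>
    then show False using contra assms(1) by simp
  qed
qed

theorem lemma5p2:
  fixes h :: "(('n::{finite,linorder}, 'a::{alg_closed_field,field_char_0}) mpoly, 'n) vec"
  assumes "homogeneous_self_vanishing h"
  shows "enat (rank (jacobian h)) = tr_deg const_field (gen_subfield h)
       \<and> tr_deg const_field (gen_subfield h)
           = krull_dim (ring_of_type_algebra\<lparr>carrier := gen_subalgebra h\<rparr>)
       \<and> krull_dim (ring_of_type_algebra\<lparr>carrier := gen_subalgebra h\<rparr>) \<le> enat (CARD('n) - 1)
       \<and> (CARD('n) \<ge> 3 \<longrightarrow>
            krull_dim (ring_of_type_algebra\<lparr>carrier := gen_subalgebra h\<rparr>) \<le> enat (CARD('n) - 2))"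
proof -
  obtain d where hom: "\<And>i. homogeneous d (h $ i)" and D: "\<And>i. lie_deriv h (h $ i) = 0"
    using assms by (auto simp: homogeneous_self_vanishing_def lie_deriv_def)
  have tr: "tr_deg const_field (gen_subfield h) = enat (rank (jacobian h))"
    by (rule tr_deg_gen_subfield)
  have krull: "krull_dim (ring_of_type_algebra\<lparr>carrier := gen_subalgebra h\<rparr>) = enat (rank (jacobian h))"
    using krull_dim_le_tr_deg[of h] rank_le_krull_dim[of h] tr by (simp add: antisym)
  show ?thesis
    using rank_jacobian_le[OF D] rank_jacobian_le_2[OF _ D hom] by (simp add: tr krull)
qed

end
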